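(* Let $M$ be a 2-semi equivelar map of combinatorial curvature $0$ on the torus or on the Klein bottle, and let $T=[f_1:f_2]$ be its type. Then $T$ (as an unordered pair of face-sequences) belongs to $\{[3^6:3^4.6]$, $[3^6:3^3.4^2]$, $[3^6:3^2.4.3.4]$, $[3^6:3^2.4.12]$, $[3^6:3^2.6^2]$, $[3^4.6:3.6.3.6]$, $[3^3.4^2:3^2.4.3.4]$, $[3^3.4^2:3.4.6.4]$, $[3^3.4^2:4^4]$, $[3^2.4.3.4:3.4.6.4]$, $[3^2.6^2:3^4.6]$, $[3^2.6^2:3.6.3.6]$, $[3.4^2.6:3.4.6.4]$, $[3.4^2.6:3.6.3.6]$, $[3.4.6.4:4.6.12]$, $[3.12^2:3.4.3.12]\}$.
   Context: A map $M$ on a surface $S$ is an embedding of a graph $G$ into $S$ such that (i) the closure of each component of $S\setminus G$ is a closed 2-disk bounded by a $p$-cycle of $G$ ($p\ge 3$), called a $p$-gonal face, and (ii) the non-empty intersection of two distinct faces is either a vertex or an edge. The face-sequence of a vertex $v$ is written $(p_1^{n_1}.p_2^{n_2}\cdots p_k^{n_k})$ if, going around $v$ in cyclic order, there are $n_1$ consecutive $p_1$-gons, then $n_2$ consecutive $p_2$-gons, ..., then $n_k$ consecutive $p_k$-gons incident with $v$ (face-sequences are considered up to cyclic rotation and reversal). The curvature of $v$ is $\phi(v)=1-\frac{1}{2}\sum_i n_i+\sum_i \frac{n_i}{p_i}$; $M$ has combinatorial curvature $0$ if $\phi(v)=0$ for every vertex $v$. A map whose vertices exhibit exactly $k$ distinct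 face-sequences $f_1,\dots,f_k$ is a $k$-semi equivelar map of type $[f_1:f_2:\cdots:f_k]$. *)

theory Defs
  imports "HOL-Analysis.Analysis"
begin

definition torus :: "'a topology \<Rightarrow> bool" where
  "torus S \<longleftrightarrow>
     S homeomorphic_space
       prod_topology (top_of_set (sphere (0::complex) 1)) (top_of_set (sphere (0::complex) 1))"

text \<open>The Klein bottle is the quotient of the plane by the group generated by the translation
  \<open>(x, y) \<mapsto> (x + 1, y)\<close> and the glide reflection \<open>(x, y) \<mapsto> (- x, y + 1)\<close>.\<close>

definition klein_bottle :: "'a topology \<Rightarrow> bool" where
  "klein_bottle S \<longleftrightarrow>
     (\<exists>q. quotient_map (euclidean :: (real \<times> real) topology) S q \<and>
        (\<forall>x y x' y'. q (x, y) = q (x', y') \<longleftrightarrow>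
           (\<exists>m n :: int. x' = (if even n then x else - x) + of_int m \<and> y' = y + of_int n)))"

text \<open>A finite graph embedded in \<open>S\<close> is given by its set \<open>V\<close> of vertices (points of \<open>S\<close>) and its
  set \<open>E\<close> of edges (closed arcs in \<open>S\<close>). The end points of an edge \<open>e\<close> are the two elements of
  \<open>e \<inter> V\<close>.\<close>

definition embedded_graph :: "'a topology \<Rightarrow> 'a set \<Rightarrow> 'a set set \<Rightarrow> bool" where
  "embedded_graph S V E \<longleftrightarrow>
     finite V \<and> V \<subseteq> topspace S \<and> finite E \<and>
     (\<forall>e\<in>E. e \<subseteq> topspace S \<and>
        (\<exists>h. homeomorphic_map (top_of_set {0..1::real}) (subtopology S e) h \<and>
             e \<inter> V = {h 0, h 1})) \<and>
     (\<forall>e\<in>E. \<forall>e'\<in>E. e \<noteq> e' \<longrightarrow> e \<inter> e' \<subseteq> V)"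

definition graph_points :: "'a set \<Rightarrow> 'a set set \<Rightarrow> 'a set" where
  "graph_points V E = V \<union> \<Union>E"

definition graph_cycle :: "'a set \<Rightarrow> 'a set set \<Rightarrow> nat \<Rightarrow> 'a set \<Rightarrow> bool" where
  "graph_cycle V E p B \<longleftrightarrow>
     p \<ge> 3 \<and>
     (\<exists>vs es. length vs = p \<and> distinct vs \<and> set vs \<subseteq> V \<and>
        length es = p \<and> distinct es \<and> set es \<subseteq> E \<and>
        (\<forall>i<p. es ! i \<inter> V = {vs ! i, vs ! (Suc i mod p)}) \<and>
        B = \<Union>(set es))"

definition open_faces :: "'a topology \<Rightarrow> 'a set \<Rightarrow> 'a set set \<Rightarrow> 'a set set" where
  "open_faces S V E = connected_components_of (subtopology S (topspace S - graph_points V E))"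

definition faces :: "'a topology \<Rightarrow> 'a set \<Rightarrow> 'a set set \<Rightarrow> 'a set set" where
  "faces S V E = (\<lambda>C. S closure_of C) ` open_faces S V E"

definition polygonal_face :: "'a topology \<Rightarrow> 'a set \<Rightarrow> 'a set set \<Rightarrow> nat \<Rightarrow> 'a set \<Rightarrow> bool" where
  "polygonal_face S V E p F \<longleftrightarrow>
     (\<exists>C\<in>open_faces S V E. F = S closure_of C \<and>
        (\<exists>h. homeomorphic_map (top_of_set (cball (0::complex) 1)) (subtopology S F) h \<and>
             h ` ball 0 1 = C \<and> graph_cycle V E p (h ` sphere 0 1)))"

definition surface_map :: "'a topology \<Rightarrow> 'a set \<Rightarrow> 'a set set \<Rightarrow> bool" where
  "surface_map S V E \<longleftrightarrow>
     embedded_graph S V E \<and>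
     (\<forall>F\<in>faces S V E. \<exists>p. polygonal_face S V E p F) \<and>
     (\<forall>F\<in>faces S V E. \<forall>F'\<in>faces S V E. F \<noteq> F' \<and> F \<inter> F' \<noteq> {} \<longrightarrow>
        (\<exists>v\<in>V. F \<inter> F' = {v}) \<or> F \<inter> F' \<in> E)"

text \<open>A face-sequence is written out as the list of the face sizes, so that \<open>3\<^sup>4.6\<close> is
  \<open>[3,3,3,3,6]\<close>. Going around \<open>v\<close> one meets, alternately, all edges and all faces at \<open>v\<close>, each
  exactly once: \<open>es ! 0, Fs ! 0, es ! 1, Fs ! 1, \<dots>\<close>. The starting point and the direction are
  arbitrary, so the lists satisfying this predicate form a class under rotation and reversal.\<close>

definition has_face_sequence :: "'a topology \<Rightarrow> 'a set \<Rightarrow> 'a set set \<Rightarrow> 'a \<Rightarrow> nat list \<Rightarrow> bool" where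
  "has_face_sequence S V E v ps \<longleftrightarrow>
     (\<exists>es Fs. length es = length ps \<and> distinct es \<and> set es = {e\<in>E. v \<in> e} \<and>
        length Fs = length ps \<and> distinct Fs \<and> set Fs = {F\<in>faces S V E. v \<in> F} \<and>
        (\<forall>i<length ps. es ! i \<subseteq> Fs ! i \<and> es ! (Suc i mod length ps) \<subseteq> Fs ! i \<and>
           polygonal_face S V E (ps ! i) (Fs ! i)))"

definition same_face_sequence :: "nat list \<Rightarrow> nat list \<Rightarrow> bool" where
  "same_face_sequence ps qs \<longleftrightarrow> (\<exists>k. qs = rotate k ps \<or> qs = rotate k (rev ps))"

definition curvature :: "nat list \<Rightarrow> real" where
  "curvature ps = 1 - real (length ps) / 2 + (\<Sum>p\<leftarrow>ps. 1 / real p)"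

definition curvature_zero :: "'a topology \<Rightarrow> 'a set \<Rightarrow> 'a set set \<Rightarrow> bool" where
  "curvature_zero S V E \<longleftrightarrow>
     (\<forall>v\<in>V. \<exists>ps. has_face_sequence S V E v ps \<and> curvature ps = 0)"

definition semi_equivelar_map ::
    "nat \<Rightarrow> 'a topology \<Rightarrow> 'a set \<Rightarrow> 'a set set \<Rightarrow> nat list list \<Rightarrow> bool" where
  "semi_equivelar_map k S V E fs \<longleftrightarrow>
     surface_map S V E \<and> length fs = k \<and>
     (\<forall>i<k. \<forall>j<k. i \<noteq> j \<longrightarrow> \<not> same_face_sequence (fs ! i) (fs ! j)) \<and>
     (\<forall>v\<in>V. \<exists>f\<in>set fs. has_face_sequence S V E v f) \<and>
     (\<forall>f\<in>set fs. \<exists>v\<in>V. has_face_sequence S V E v f)"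

definition same_type :: "nat list \<times> nat list \<Rightarrow> nat list \<times> nat list \<Rightarrow> bool" where
  "same_type T T' \<longleftrightarrow>
     same_face_sequence (fst T) (fst T') \<and> same_face_sequence (snd T) (snd T') \<or>
     same_face_sequence (fst T) (snd T') \<and> same_face_sequence (snd T) (fst T')"

end

theory Submission
  imports Defs
begin

text \<open>The equation \<open>\<phi>(v) = 0\<close> has 21 solutions up to rotation and reversal. Attach to every flag
  \<open>(v, e, F)\<close> its view: the sizes of the faces at \<open>v\<close>, read off cyclically starting with \<open>F\<close> and moving
  away from \<open>e\<close>. The views from the two ends of an edge agree in their first and last entries, and
  walking once around a face must lead back to the initial view. Start with all pairs of views that
  agree at an edge and repeatedly discard the pairs that do not extend to closed walks around both
  adjacent faces. For all pairs of distinct face-sequences outside the list, after at most three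
  rounds no edge can join vertices of different kinds; but such an edge exists, because the torus
  and the Klein bottle are connected. Only the walks around triangles and quadrangles are needed.\<close>

section \<open>Face-sequences of curvature zero\<close>

text \<open>The hypotheses are topological, while the exclusion of a pair is a finite search. The
  bridge is the system of flags with its three involutions, each of which needs a set of exactly two
  elements: an edge has two ends because it is an arc, a face has two edges at each of its vertices
  because its boundary is a graph cycle, and an edge lies in two faces because the face-sequence at
  one of its ends lists the faces there cyclically. A view fixes the start and the direction of a
  face-sequence, so the moves between flags become operations on lists. The refinement is evaluated
  for few pairs. Two types can be joined by an edge only if some edge of each has the same two face
  sizes on its sides. Of the pairs of distinct flat types, 40 pass this test: the 16 of the theorem
  and 24 others.\<close>

definition dihedral :: "nat list \<Rightarrow> nat list list" where
  "dihedral f = remdups (concat (map (\<lambda>k. [rotate k f, rotate k (rev f)]) [0..<length f]))"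

text \<open>There are 17 multisets of sizes; 3,3,3,4,4 and 3,3,4,12 and 3,3,6,6 and 3,4,4,6 each
  admit two cyclic orders, which gives 21 entries.\<close>

definition flat_types :: "nat list list" where
  "flat_types =
     [[3,3,3,3,3,3], [3,3,3,3,6], [3,3,3,4,4], [3,3,4,3,4], [3,3,4,12], [3,4,3,12], [3,3,6,6],
      [3,6,3,6], [3,4,4,6], [3,4,6,4], [4,4,4,4], [3,7,42], [3,8,24], [3,9,18], [3,10,15],
      [3,12,12], [4,5,20], [4,6,12], [4,8,8], [5,5,10], [6,6,6]]"

section \<open>Rotation and reversal as an equivalence relation\<close>

lemma rotate_inverse: "\<exists>j. rotate j (rotate k xs) = xs"
proof (cases "xs = []")
  case False
  then have "k \<le> length xs * Suc k"
    by (cases xs) simp_all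
  \<comment> \<open>A multiple of the length that is at least \<open>k\<close>, so that the
    truncated difference is a genuine inverse rotation.\<close>
  then have "rotate (length xs * Suc k - k) (rotate k xs) = rotate (length xs * Suc k) xs"
    by (simp add: rotate_rotate)
  also have "\<dots> = xs"
    by (simp add: rotate_id)
  finally show ?thesis
    by blast
qed simp

lemma rev_rotate: "\<exists>j. rev (rotate k xs) = rotate j (rev xs)"
proof -
  have "rev (rotate k xs) =
      rev (rotate (length xs - (length xs - k mod length xs) mod length xs) xs)"
    by (cases "xs = []"; cases "k mod length xs = 0") (auto simp: rotate_id rotate_conv_mod[of k xs])
  then show ?thesis
    by (metis rotate_rev)
qed

lemma same_face_sequence_sym:
  assumes "same_face_sequence f g"
  shows "same_face_sequence g f"
proof -
  obtain k where k: "g = rotate k f \<or> g = rotate k (rev f)"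
    using assms unfolding same_face_sequence_def by blast
  obtain i where i: "rotate i (rotate k f) = f"
    using rotate_inverse by blast
  obtain j where "rotate j (rotate k (rev f)) = rev f"
    using rotate_inverse by blast
  then have "f = rev (rotate j (rotate k (rev f)))"
    by simp
  moreover obtain l where "rev (rotate j (rotate k (rev f))) = rotate l (rev (rotate k (rev f)))"
    using rev_rotate by blast
  ultimately show ?thesis
    using k i unfolding same_face_sequence_def by metis
qed

lemma same_face_sequence_trans:
  assumes "same_face_sequence f g" and "same_face_sequence g h"
  shows "same_face_sequence f h"
proof -
  obtain k where k: "g = rotate k f \<or> g = rotate k (rev f)"
    using assms(1) unfolding same_face_sequence_def by blast
  obtain l where l: "h = rotate l g \<or> h = rotate l (rev g)"
    using assms(2) unfolding same_face_sequence_def by blast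
  obtain j where j: "rev (rotate k f) = rotate j (rev f)"
    using rev_rotate by blast
  obtain j' where j': "rev (rotate k (rev f)) = rotate j' f"
    using rev_rotate[of k "rev f"] by auto
  from k l j j' show ?thesis
    unfolding same_face_sequence_def by (metis rotate_rotate)
qed

lemma set_dihedral:
  assumes "f \<noteq> []"
  shows "set (dihedral f) = {w. same_face_sequence f w}"
proof -
  have "\<exists>j < length f. rotate k f = rotate j f \<and> rotate k (rev f) = rotate j (rev f)" for k
    using assms rotate_conv_mod[of k f] rotate_conv_mod[of k "rev f"]
    by (intro exI[of _ "k mod length f"]) auto
  then show ?thesis
    unfolding dihedral_def same_face_sequence_def
    by (fastforce simp: atLeast0LessThan)
qed

section \<open>Integer solutions of the curvature equation\<close>

lemma recip_bound:
  assumes "1 / real (Suc k) < 1 / real n"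
  shows "n \<le> k"
proof (rule ccontr)
  assume "\<not> n \<le> k"
  then have "1 / real n \<le> 1 / real (Suc k)"
    by (intro frac_le) auto
  then show False
    using assms by simp
qed

lemma recip_antimono:
  assumes "0 < m" "m \<le> n"
  shows "1 / real n \<le> 1 / real m"
  using assms by (intro frac_le) auto

text \<open>After clearing denominators the last unknown satisfies a linear equation. Over the
  naturals \<open>presburger\<close> refutes it when its solution is not an integer: for sizes 3 and
  11 the third would have to be 66/5.\<close>

lemma numeral_times_of_nat_eq:
  "numeral k * real c = numeral m \<longleftrightarrow> numeral k * c = numeral m"
  "real c * numeral k = numeral m \<longleftrightarrow> c * numeral k = numeral m"
  by (metis of_nat_eq_iff of_nat_mult of_nat_numeral)+

definition flat_multisets :: "nat list list" where
  "flat_multisets =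
     [[3,3,3,3,3,3], [3,3,3,3,6], [3,3,3,4,4], [3,3,4,12], [3,3,6,6], [3,4,4,6], [4,4,4,4],
      [3,7,42], [3,8,24], [3,9,18], [3,10,15], [3,12,12], [4,5,20], [4,6,12], [4,8,8],
      [5,5,10], [6,6,6]]"

text \<open>The largest reciprocal \<open>1 / a\<close> is at least a third of the sum, so
  \<open>a \<le> 6\<close>. With \<open>a\<close> fixed, \<open>1 / b\<close> is at least half of
  the remainder, which bounds \<open>b\<close>, and \<open>c\<close> is then determined. Longer
  sequences yield to the same successive bounds.\<close>

lemma flat_triples:
  assumes "3 \<le> a" "a \<le> b" "b \<le> c" and eq: "1 / real a + 1 / real b + 1 / real c = 1 / 2"
  shows "[a, b, c] \<in> set flat_multisets"
proof -
  have m: "1 / real b \<le> 1 / real a" "1 / real c \<le> 1 / real b"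
    using assms by (auto intro!: recip_antimono)
  have c: "0 < real c"
    using assms by simp
  have "a \<le> 6"
    by (rule recip_bound) (use m eq in simp)
  then consider "a = 3" | "a = 4" | "a = 5" | "a = 6"
    using assms(1) by linarith
  then show ?thesis
  proof cases
    case 1
    have "b \<le> 12"
      by (rule recip_bound) (use m eq 1 in simp)
    \<comment> \<open>For these values the first two terms already reach 1/2, leaving nothing for
      the positive \<open>1 / c\<close>.\<close>
    moreover have "b \<noteq> 3" "b \<noteq> 4" "b \<noteq> 5" "b \<noteq> 6"
      using eq 1 c by (auto simp: field_simps)
    ultimately have "b \<in> {7, 8, 9, 10, 11, 12}"
      using assms(2) 1 unfolding insert_iff empty_iff by presburger
    then show ?thesis
      using eq 1 c
      by (elim insertE emptyE; simp add: field_simps numeral_times_of_nat_eq flat_multisets_def; presburger?)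
  next
    case 2
    have "b \<le> 8"
      by (rule recip_bound) (use m eq 2 in simp)
    moreover have "b \<noteq> 4" using eq 2 c by (auto simp: field_simps)
    ultimately have "b \<in> {5, 6, 7, 8}"
      using assms(2) 2 unfolding insert_iff empty_iff by presburger
    then show ?thesis
      using eq 2 c
      by (elim insertE emptyE; simp add: field_simps numeral_times_of_nat_eq flat_multisets_def; presburger?)
  next
    case 3
    have "b \<le> 6"
      by (rule recip_bound) (use m eq 3 in simp)
    then have "b \<in> {5, 6}"
      using assms 3 by auto
    then show ?thesis
      using eq 3 c
      by (elim insertE emptyE; simp add: field_simps numeral_times_of_nat_eq flat_multisets_def; presburger?)
  next
    case 4
    have "b \<le> 6"
      by (rule recip_bound) (use m eq 4 in simp)
    then have "b = 6"
      using assms 4 by auto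
    then show ?thesis
      using eq 4 c by (simp add: field_simps flat_multisets_def)
  qed
qed

lemma flat_quadruples:
  assumes "3 \<le> a" "a \<le> b" "b \<le> c" "c \<le> d"
    and eq: "1 / real a + 1 / real b + 1 / real c + 1 / real d = 1"
  shows "[a, b, c, d] \<in> set flat_multisets"
proof -
  have m: "1 / real b \<le> 1 / real a" "1 / real c \<le> 1 / real b" "1 / real d \<le> 1 / real c"
    using assms by (auto intro!: recip_antimono)
  have d: "0 < real d"
    using assms by simp
  have "a \<le> 4"
    by (rule recip_bound) (use m eq in simp)
  then consider "a = 3" | "a = 4"
    using assms(1) by linarith
  then show ?thesis
  proof cases
    case 1
    have "b \<le> 4"
      by (rule recip_bound) (use m eq 1 in simp)
    then consider "b = 3" | "b = 4"
      using assms 1 by linarith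
    then show ?thesis
    proof cases
      assume b: "b = 3"
      have "c \<le> 6"
        by (rule recip_bound) (use m eq 1 b in simp)
      moreover have "c \<noteq> 3"
        using eq 1 b d by (auto simp: field_simps)
      ultimately have "c \<in> {4, 5, 6}"
        using assms b by auto
      then show ?thesis
        using eq 1 b d
        by (elim insertE emptyE; simp add: field_simps numeral_times_of_nat_eq flat_multisets_def; presburger?)
    next
      assume b: "b = 4"
      have "c \<le> 4"
        by (rule recip_bound) (use m eq 1 b in simp)
      then have "c = 4"
        using assms b by simp
      then show ?thesis
        using eq 1 b d by (simp add: field_simps flat_multisets_def)
    qed
  next
    case 2
    have "c \<le> 4"
      by (rule recip_bound) (use m eq 2 in simp)
    then have "b = 4" "c = 4"
      using assms 2 by simp_all
    then show ?thesis
      using eq 2 d by (simp add: field_simps flat_multisets_def)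
  qed
qed

lemma flat_quintuples:
  assumes "3 \<le> a" "a \<le> b" "b \<le> c" "c \<le> d" "d \<le> e"
    and eq: "1 / real a + 1 / real b + 1 / real c + 1 / real d + 1 / real e = 3 / 2"
  shows "[a, b, c, d, e] \<in> set flat_multisets"
proof -
  have m: "1 / real a \<le> 1 / 3" "1 / real b \<le> 1 / real a" "1 / real c \<le> 1 / real b"
    "1 / real d \<le> 1 / real c" "1 / real e \<le> 1 / real d"
    using assms recip_antimono[of 3 a] by (auto intro!: recip_antimono)
  have e: "0 < real e"
    using assms by simp
  \<comment> \<open>The first two terms contribute at most 2/3, so the last three contribute at
    least 5/6 and \<open>1 / c\<close> is at least 5/18, which exceeds 1/4.\<close>
  have "c \<le> 3"
    by (rule recip_bound) (use m eq in simp)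
  then have abc: "a = 3" "b = 3" "c = 3"
    using assms by simp_all
  have "d \<le> 4"
    by (rule recip_bound) (use m eq abc in simp)
  then have "d \<in> {3, 4}"
    using assms abc by auto
  then show ?thesis
    using eq abc e by (elim insertE emptyE; simp add: field_simps flat_multisets_def)
qed

lemma sum_list_recip_le:
  assumes "\<forall>p\<in>set s. 3 \<le> (p::nat)"
  shows "(\<Sum>p\<leftarrow>s. 1 / real p) \<le> real (length s) / 3"
  using assms
proof (induction s)
  case (Cons p s)
  have "1 / real p \<le> 1 / 3"
    using recip_antimono[of 3 p] Cons.prems by simp
  moreover have "real (length (p # s)) / 3 = 1 / 3 + real (length s) / 3"
    by (simp add: add_divide_distrib)
  moreover have "(\<Sum>p\<leftarrow>s. 1 / real p) \<le> real (length s) / 3"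
    using Cons by simp
  ultimately show ?case
    unfolding list.map sum_list.Cons by linarith
qed simp

lemma sorted_flat:
  assumes "sorted s" and ge3: "\<forall>p\<in>set s. 3 \<le> p" and eq: "curvature s = 0"
  shows "s \<in> set flat_multisets"
proof -
  \<comment> \<open>A sequence of length \<open>n\<close> satisfies
    \<open>n / 2 - 1 \<le> n / 3\<close>.\<close>
  have "length s \<le> 6"
    using sum_list_recip_le[OF ge3] eq by (simp add: curvature_def)
  then consider "length s = 0" | "length s = 1" | "length s = 2" | "length s = 3" | "length s = 4"
    | "length s = 5" | "length s = 6"
    by linarith
  then show ?thesis
  proof cases
    case 1
    then show ?thesis using eq by (simp add: curvature_def)
  next
    case 2
    then obtain a where "s = [a]"
      by (auto simp: length_Suc_conv)
    moreover have "0 < 1 / 2 + 1 / real a"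
      by (simp add: add_pos_nonneg)
    ultimately show ?thesis
      using eq by (simp add: curvature_def)
  next
    case 3
    then obtain a b where s: "s = [a, b]"
      by (auto simp: length_Suc_conv numeral_eq_Suc)
    then have "0 < 1 / real a + 1 / real b"
      using ge3 by (auto intro!: add_pos_pos)
    then show ?thesis
      using eq s by (simp add: curvature_def)
  next
    case 4
    then obtain a b c where s: "s = [a, b, c]"
      by (auto simp: length_Suc_conv numeral_eq_Suc)
    show ?thesis
      unfolding s by (rule flat_triples) (use assms s in \<open>simp_all add: curvature_def\<close>)
  next
    case 5
    then obtain a b c d where s: "s = [a, b, c, d]"
      by (auto simp: length_Suc_conv numeral_eq_Suc)
    show ?thesis
      unfolding s by (rule flat_quadruples) (use assms s in \<open>simp_all add: curvature_def\<close>)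
  next
    case 6
    then obtain a b c d e where s: "s = [a, b, c, d, e]"
      by (auto simp: length_Suc_conv numeral_eq_Suc)
    show ?thesis
      unfolding s by (rule flat_quintuples) (use assms s in \<open>simp_all add: curvature_def\<close>)
  next
    case 7
    then obtain a b c d e f where s: "s = [a, b, c, d, e, f]"
      by (auto simp: length_Suc_conv numeral_eq_Suc)
    have m: "1 / real f \<le> 1 / real e" "1 / real e \<le> 1 / real d" "1 / real d \<le> 1 / real c"
      "1 / real c \<le> 1 / real b" "1 / real b \<le> 1 / real a" "1 / real a \<le> 1 / 3"
      using assms s recip_antimono[of 3 a] by (auto intro!: recip_antimono)
    have "f \<le> 3"
      by (rule recip_bound) (use m eq s in \<open>simp add: curvature_def\<close>)
    then have "s = [3, 3, 3, 3, 3, 3]"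
      using assms(1) ge3 s by auto
    then show ?thesis
      by (simp add: flat_multisets_def)
  qed
qed

text \<open>Passes from multisets to cyclic orders: every word that sorts to one of the multisets is
  enumerated and found equivalent to an entry of \<open>flat_types\<close>.\<close>

lemma arrangements_flat_types:
  "list_all (\<lambda>s. list_all
     (\<lambda>ps. if sort ps = s then list_ex (\<lambda>g. g \<in> set (dihedral ps)) flat_types else True)
     (List.n_lists (length s) (remdups s))) flat_multisets"
  by code_simp

lemma flat_face_sequence:
  assumes "\<forall>p\<in>set ps. 3 \<le> p" and "curvature ps = 0"
  shows "\<exists>g\<in>set flat_types. same_face_sequence ps g"
proof -
  have "(\<Sum>p\<leftarrow>sort ps. 1 / real p) = (\<Sum>p\<leftarrow>ps. 1 / real p)"
    by (simp only: mset_map mset_sort flip: sum_mset_sum_list)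
  then have "curvature (sort ps) = 0"
    using assms(2) by (simp add: curvature_def)
  then have s: "sort ps \<in> set flat_multisets"
    using assms(1) by (intro sorted_flat) auto
  have "ps \<in> set (List.n_lists (length (sort ps)) (remdups (sort ps)))"
    by (auto simp: set_n_lists)
  then obtain g where "g \<in> set flat_types" "g \<in> set (dihedral ps)"
    using arrangements_flat_types s unfolding list_all_iff list_ex_iff by (metis (no_types))
  moreover have "ps \<noteq> []"
    using assms(2) by (auto simp: curvature_def)
  ultimately show ?thesis
    by (auto simp: set_dihedral)
qed

section \<open>Views in a system of flags\<close>

text \<open>The same vertex read in the opposite sense from the same face: the first entry stays,
  the others are reversed. This is the effect of replacing \<open>e\<close> by the other edge of
  \<open>F\<close> at the vertex.\<close>

definition turn :: "nat list \<Rightarrow> nat list" where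
  "turn w = rev (rotate1 w)"

text \<open>A pair \<open>(w, x)\<close> stands for the views of \<open>(u, e, F)\<close> and \<open>(v, e, F)\<close>, where \<open>u\<close> and \<open>v\<close> are the ends
  of \<open>e\<close>. The next edge along \<open>F\<close> is then seen from \<open>v\<close> as \<open>turn x\<close>.\<close>

definition edge_pairs :: "nat list list \<Rightarrow> (nat list \<times> nat list) list" where
  "edge_pairs ws = [(w, x) \<leftarrow> List.product ws ws. hd w = hd x \<and> last w = last x]"

text \<open>The nested conditionals below avoid the evaluation of irrelevant branches by the simplifier.\<close>

fun reach ::
    "(nat list \<times> nat list) list \<Rightarrow> nat \<Rightarrow> (nat list \<times> nat list) list \<Rightarrow> nat list \<Rightarrow> nat list \<Rightarrow> bool"
where
  "reach N 0 M a c \<longleftrightarrow> a = c"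
| "reach N (Suc k) [] a c \<longleftrightarrow> False"
| "reach N (Suc k) ((a', b) # M) a c \<longleftrightarrow>
     (if a' = a then if reach N k N b c then True else reach N (Suc k) M a c
      else reach N (Suc k) M a c)"

text \<open>\<open>N\<close> is the one-step relation along a face. The pair \<open>(w, x)\<close>
  itself is the first of the \<open>hd w\<close> steps, which leaves \<open>hd w - 1\<close> from
  \<open>turn x\<close> back to \<open>w\<close>.\<close>

definition closes :: "(nat list \<times> nat list) list \<Rightarrow> nat list \<Rightarrow> nat list \<Rightarrow> bool" where
  "closes N w x \<longleftrightarrow> (if hd w \<le> 4 then reach N (hd w - 1) N (turn x) w else True)"

fun has_key :: "(nat list \<times> nat list) list \<Rightarrow> nat list \<Rightarrow> bool" where
  "has_key [] w \<longleftrightarrow> False"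
| "has_key ((a, b) # N) w \<longleftrightarrow> (if a = w then True else has_key N w)"

text \<open>\<open>rev\<close> exchanges the two faces at the edge. The test on
  \<open>rotate1 w\<close>, the view along the next edge at the vertex, makes a deletion at one edge
  spread to the neighbouring edges in later rounds.\<close>

fun refine_by ::
    "(nat list \<times> nat list) list \<Rightarrow> (nat list \<times> nat list) list \<Rightarrow> (nat list \<times> nat list) list" where
  "refine_by N [] = []"
| "refine_by N ((w, x) # P) =
     (if has_key N (rotate1 w)
      then if closes N w x
        then if closes N (rev w) (rev x) then (w, x) # refine_by N P else refine_by N P
        else refine_by N P
      else refine_by N P)"

definition refine :: "(nat list \<times> nat list) list \<Rightarrow> (nat list \<times> nat list) list" where
  "refine P = refine_by (map (\<lambda>(w, x). (w, turn x)) P) P"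

text \<open>A necessary condition for an edge from type \<open>f\<close> to type \<open>g\<close> in
  a map whose vertices have these two types.\<close>

definition compatible :: "nat list \<Rightarrow> nat list \<Rightarrow> bool" where
  "compatible f g \<longleftrightarrow>
     list_ex (\<lambda>(w, x). w \<in> set (dihedral f) \<and> x \<in> set (dihedral g))
       (refine (refine (refine (edge_pairs (dihedral f @ dihedral g)))))"

text \<open>The condition before any refinement, cheap enough to be evaluated for all pairs from
  \<open>flat_types\<close>.\<close>

definition share_edge :: "nat list \<Rightarrow> nat list \<Rightarrow> bool" where
  "share_edge f g \<longleftrightarrow>
     list_ex (\<lambda>w. list_ex (\<lambda>x. hd w = hd x \<and> last w = last x) (dihedral g)) (dihedral f)"

lemma rotate1_turn: "rotate1 (turn w) = rev w"
  by (cases w) (simp_all add: turn_def)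

lemma reach_Suc: "(a, b) \<in> set M \<Longrightarrow> reach N k N b c \<Longrightarrow> reach N (Suc k) M a c"
  by (induction M) auto

lemma has_key_iff: "has_key N w \<longleftrightarrow> w \<in> fst ` set N"
  by (induction N) auto

lemma set_refine_by:
  "set (refine_by N P) = {(w, x) \<in> set P.
     has_key N (rotate1 w) \<and> closes N w x \<and> closes N (rev w) (rev x)}"
  by (induction N P rule: refine_by.induct) auto

text \<open>\<open>s0\<close>, \<open>s1\<close>, \<open>s2\<close> change the vertex, the edge and the face of a flag \<open>(v, e, F)\<close>; \<open>size\<close> is the
  number of edges of \<open>F\<close> and \<open>deg\<close> the number of edges at \<open>v\<close>.\<close>

locale flag_system =
  fixes X :: "'f set" and s0 s1 s2 :: "'f \<Rightarrow> 'f" and size deg :: "'f \<Rightarrow> nat"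
  assumes closed: "\<phi> \<in> X \<Longrightarrow> s0 \<phi> \<in> X" "\<phi> \<in> X \<Longrightarrow> s1 \<phi> \<in> X" "\<phi> \<in> X \<Longrightarrow> s2 \<phi> \<in> X"
    and invol: "\<phi> \<in> X \<Longrightarrow> s0 (s0 \<phi>) = \<phi>" "\<phi> \<in> X \<Longrightarrow> s1 (s1 \<phi>) = \<phi>" "\<phi> \<in> X \<Longrightarrow> s2 (s2 \<phi>) = \<phi>"
    and commute: "\<phi> \<in> X \<Longrightarrow> s0 (s2 \<phi>) = s2 (s0 \<phi>)"
    and size: "\<phi> \<in> X \<Longrightarrow> size (s0 \<phi>) = size \<phi>" "\<phi> \<in> X \<Longrightarrow> size (s1 \<phi>) = size \<phi>"
    and deg: "\<phi> \<in> X \<Longrightarrow> deg (s1 \<phi>) = deg \<phi>" "\<phi> \<in> X \<Longrightarrow> deg (s2 \<phi>) = deg \<phi>"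
    and pos: "\<phi> \<in> X \<Longrightarrow> 0 < size \<phi>" "\<phi> \<in> X \<Longrightarrow> 0 < deg \<phi>"
    and around_vertex: "\<phi> \<in> X \<Longrightarrow> ((\<lambda>\<phi>. s2 (s1 \<phi>)) ^^ deg \<phi>) \<phi> = \<phi>"
    and around_face: "\<phi> \<in> X \<Longrightarrow> ((\<lambda>\<phi>. s1 (s0 \<phi>)) ^^ size \<phi>) \<phi> = \<phi>"
begin

text \<open>The face sizes around \<open>v\<close> in cyclic order, from \<open>F\<close> on and moving away from \<open>e\<close>. Hence \<open>e\<close>
  separates the last entry from the first one.\<close>

definition view :: "'f \<Rightarrow> nat list" where
  "view \<phi> = map (\<lambda>i. size (((\<lambda>\<phi>. s2 (s1 \<phi>)) ^^ i) \<phi>)) [0..<deg \<phi>]"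

lemma funpow_closed:
  assumes "\<phi> \<in> X"
  shows "((\<lambda>\<phi>. s2 (s1 \<phi>)) ^^ i) \<phi> \<in> X"
  using assms by (induction i) (simp_all add: closed)

lemma hd_view:
  assumes "\<phi> \<in> X"
  shows "hd (view \<phi>) = size \<phi>"
  using pos(2)[OF assms] by (simp add: view_def hd_map upt_conv_Cons)

lemma view_rotate:
  assumes "\<phi> \<in> X"
  shows "view (s2 (s1 \<phi>)) = rotate1 (view \<phi>)"
proof (rule nth_equalityI)
  have d: "deg (s2 (s1 \<phi>)) = deg \<phi>"
    using assms by (simp add: deg closed)
  then show "length (view (s2 (s1 \<phi>))) = length (rotate1 (view \<phi>))"
    by (simp add: view_def)
  fix i assume "i < length (view (s2 (s1 \<phi>)))"
  then have i: "i < deg \<phi>"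
    by (simp add: view_def d)
  have "view (s2 (s1 \<phi>)) ! i = size (((\<lambda>\<phi>. s2 (s1 \<phi>)) ^^ Suc i) \<phi>)"
    using i by (simp add: view_def d funpow_Suc_right del: funpow.simps)
  moreover have "rotate1 (view \<phi>) ! i = size (((\<lambda>\<phi>. s2 (s1 \<phi>)) ^^ (Suc i mod deg \<phi>)) \<phi>)"
    using i pos(2)[OF assms] by (simp add: view_def nth_rotate1)
  moreover have "((\<lambda>\<phi>. s2 (s1 \<phi>)) ^^ Suc i) \<phi> = ((\<lambda>\<phi>. s2 (s1 \<phi>)) ^^ (Suc i mod deg \<phi>)) \<phi>"
    using i around_vertex[OF assms] by (cases "Suc i = deg \<phi>") simp_all
  ultimately show "view (s2 (s1 \<phi>)) ! i = rotate1 (view \<phi>) ! i"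
    by simp
qed

text \<open>\<open>s1\<close> conjugates the rotation about the vertex (\<open>s1\<close>, then
  \<open>s2\<close>) into its inverse, as in a dihedral group.\<close>

lemma funpow_reflect:
  assumes "\<phi> \<in> X"
  shows "((\<lambda>\<phi>. s2 (s1 \<phi>)) ^^ i) (s1 (((\<lambda>\<phi>. s2 (s1 \<phi>)) ^^ i) \<phi>)) = s1 \<phi>"
proof (induction i)
  case (Suc i)
  define \<psi> where "\<psi> = ((\<lambda>\<phi>. s2 (s1 \<phi>)) ^^ i) \<phi>"
  have \<psi>: "\<psi> \<in> X"
    unfolding \<psi>_def by (rule funpow_closed[OF assms])
  have "((\<lambda>\<phi>. s2 (s1 \<phi>)) ^^ Suc i) (s1 (((\<lambda>\<phi>. s2 (s1 \<phi>)) ^^ Suc i) \<phi>)) =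
      ((\<lambda>\<phi>. s2 (s1 \<phi>)) ^^ i) (s2 (s1 (s1 (s2 (s1 \<psi>)))))"
    by (subst funpow_Suc_right) (simp add: \<psi>_def)
  also have "\<dots> = ((\<lambda>\<phi>. s2 (s1 \<phi>)) ^^ i) (s1 \<psi>)"
    using \<psi> by (simp add: closed invol)
  also have "\<dots> = s1 \<phi>"
    using Suc.IH by (simp only: \<psi>_def)
  finally show ?case .
qed simp

lemma view_turn:
  assumes "\<phi> \<in> X"
  shows "view (s1 \<phi>) = turn (view \<phi>)"
proof (rule nth_equalityI)
  have d: "deg (s1 \<phi>) = deg \<phi>"
    using assms by (simp add: deg)
  then show "length (view (s1 \<phi>)) = length (turn (view \<phi>))"
    by (simp add: view_def turn_def)
  fix i assume "i < length (view (s1 \<phi>))"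
  then have i: "i < deg \<phi>"
    by (simp add: view_def d)
  \<comment> \<open>This is the rotation by \<open>-i\<close>, its exponent made nonnegative by
    \<open>around_vertex\<close>. Applying \<open>s1\<close> to it gives the flag read at position
    \<open>i\<close> from \<open>s1 \<phi>\<close>, with the same face size.\<close>
  define \<psi> where "\<psi> = ((\<lambda>\<phi>. s2 (s1 \<phi>)) ^^ (deg \<phi> - i)) \<phi>"
  have \<psi>: "\<psi> \<in> X"
    unfolding \<psi>_def by (rule funpow_closed[OF assms])
  have "((\<lambda>\<phi>. s2 (s1 \<phi>)) ^^ i) \<psi> = \<phi>"
    using i around_vertex[OF assms] unfolding \<psi>_def
    by (metis add_diff_inverse_nat comp_apply funpow_add less_imp_le_nat not_le)
  then have "((\<lambda>\<phi>. s2 (s1 \<phi>)) ^^ i) (s1 \<phi>) = s1 \<psi>"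
    using funpow_reflect[OF \<psi>, of i] by simp
  then have "view (s1 \<phi>) ! i = size \<psi>"
    using i \<psi> by (simp add: view_def d size)
  moreover have "turn (view \<phi>) ! i = view \<phi> ! ((deg \<phi> - i) mod deg \<phi>)"
    using i by (simp add: turn_def rev_nth nth_rotate1 view_def Suc_diff_Suc)
  moreover have "view \<phi> ! ((deg \<phi> - i) mod deg \<phi>) = size \<psi>"
    using i around_vertex[OF assms] by (cases "i = 0") (simp_all add: view_def \<psi>_def)
  ultimately show "view (s1 \<phi>) ! i = turn (view \<phi>) ! i"
    by simp
qed

lemma view_rev:
  assumes "\<phi> \<in> X"
  shows "view (s2 \<phi>) = rev (view \<phi>)"
  using view_rotate[of "s1 \<phi>"] view_turn[of \<phi>] assms
  by (simp add: closed invol rotate1_turn)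

lemma hd_view_s0: 
  assumes "\<phi> \<in> X"
  shows "hd (view (s0 \<phi>)) = hd (view \<phi>)"
  using assms by (simp add: hd_view closed size)

text \<open>The last entry is the first one seen after crossing the edge, and \<open>s0\<close>
  commutes with crossing.\<close>

lemma last_view_s0:
  assumes "\<phi> \<in> X"
  shows "last (view (s0 \<phi>)) = last (view \<phi>)"
proof -
  have "hd (view (s0 (s2 \<phi>))) = hd (view (s2 \<phi>))"
    using assms by (simp add: hd_view_s0 closed)
  then show ?thesis
    using assms by (simp add: commute view_rev closed hd_rev)
qed

lemma in_edge_pairs:
  assumes "\<And>\<phi>. \<phi> \<in> X \<Longrightarrow> view \<phi> \<in> set ws" and "\<phi> \<in> X"
  shows "(view \<phi>, view (s0 \<phi>)) \<in> set (edge_pairs ws)"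
  using assms by (simp add: edge_pairs_def hd_view_s0 last_view_s0 closed)

lemma reach_around_face:
  assumes P: "\<And>\<phi>. \<phi> \<in> X \<Longrightarrow> (view \<phi>, view (s0 \<phi>)) \<in> set P" and "\<phi> \<in> X"
  shows "reach (map (\<lambda>(w, x). (w, turn x)) P) k (map (\<lambda>(w, x). (w, turn x)) P)
    (view \<phi>) (view (((\<lambda>\<phi>. s1 (s0 \<phi>)) ^^ k) \<phi>))"
  using assms(2)
proof (induction k arbitrary: \<phi>)
  case (Suc k)
  have "(view \<phi>, turn (view (s0 \<phi>))) \<in> set (map (\<lambda>(w, x). (w, turn x)) P)"
    using P[OF Suc.prems] by force
  moreover have "turn (view (s0 \<phi>)) = view (s1 (s0 \<phi>))"
    using Suc.prems by (simp add: view_turn closed)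
  ultimately show ?case
    using reach_Suc[OF _ Suc.IH[of "s1 (s0 \<phi>)"]] Suc.prems
    by (simp add: closed funpow_Suc_right del: funpow.simps reach.simps set_map)
qed simp

lemma closes_view:
  assumes P: "\<And>\<phi>. \<phi> \<in> X \<Longrightarrow> (view \<phi>, view (s0 \<phi>)) \<in> set P" and "\<phi> \<in> X"
  shows "closes (map (\<lambda>(w, x). (w, turn x)) P) (view \<phi>) (view (s0 \<phi>))"
proof -
  define k where "k = size \<phi> - 1"
  have "((\<lambda>\<phi>. s1 (s0 \<phi>)) ^^ k) (s1 (s0 \<phi>)) = ((\<lambda>\<phi>. s1 (s0 \<phi>)) ^^ Suc k) \<phi>"
    by (simp add: funpow_Suc_right del: funpow.simps)
  also have "\<dots> = \<phi>"
    using around_face[OF assms(2)] pos(1)[OF assms(2)] by (simp add: k_def del: funpow.simps)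
  finally have "reach (map (\<lambda>(w, x). (w, turn x)) P) k (map (\<lambda>(w, x). (w, turn x)) P)
      (view (s1 (s0 \<phi>))) (view \<phi>)"
    using reach_around_face[of P "s1 (s0 \<phi>)" k] assms by (simp add: closed)
  then show ?thesis
    using assms(2) by (simp add: closes_def hd_view view_turn closed k_def)
qed

text \<open>Soundness of a round: a pair realized by a flag survives, because the walks around both
  faces and the next edge at the vertex are again realized by flags, whose pairs lie in
  \<open>P\<close>.\<close>

lemma in_refine:
  assumes P: "\<And>\<phi>. \<phi> \<in> X \<Longrightarrow> (view \<phi>, view (s0 \<phi>)) \<in> set P" and "\<phi> \<in> X"
  shows "(view \<phi>, view (s0 \<phi>)) \<in> set (refine P)"
proof -
  have "closes (map (\<lambda>(w, x). (w, turn x)) P) (rev (view \<phi>)) (rev (view (s0 \<phi>)))"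
    using closes_view[of P "s2 \<phi>"] assms by (simp add: closed view_rev commute)
  moreover have "(rotate1 (view \<phi>), view (s0 (s2 (s1 \<phi>)))) \<in> set P"
    using P[of "s2 (s1 \<phi>)"] assms(2) by (simp add: closed view_rotate)
  ultimately show ?thesis
    using assms closes_view[OF assms]
    by (force simp: refine_def set_refine_by has_key_iff)
qed

lemma compatible_views:
  assumes "\<And>\<phi>. \<phi> \<in> X \<Longrightarrow> view \<phi> \<in> set (dihedral f) \<union> set (dihedral g)"
    and "\<phi> \<in> X" and "view \<phi> \<in> set (dihedral f)" and "view (s0 \<phi>) \<in> set (dihedral g)"
  shows "share_edge f g" and "compatible f g"
proof -
  show "share_edge f g"
    using assms(2-4) hd_view_s0 last_view_s0
    unfolding share_edge_def list_ex_iff by metis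
  have "(view \<phi>, view (s0 \<phi>)) \<in> set (refine (refine (refine (edge_pairs (dihedral f @ dihedral g)))))"
    by (intro in_refine in_edge_pairs assms(2)) (use assms(1) in auto)
  then show "compatible f g"
    using assms(3,4) unfolding compatible_def list_ex_iff by blast
qed

end

section \<open>Cyclic arrangements\<close>

definition other :: "'a set \<Rightarrow> 'a \<Rightarrow> 'a" where
  "other A x = (THE y. y \<in> A \<and> y \<noteq> x)"

lemma other_doubleton:
  assumes "x \<noteq> y"
  shows "other {x, y} x = y" "other {x, y} y = x"
  using assms by (auto simp: other_def)

lemma other_card_2:
  assumes "card A = 2" "x \<in> A"
  shows "other A x \<in> A" "other A x \<noteq> x" "other A (other A x) = x"
proof -
  obtain y where "A = {x, y}" "x \<noteq> y"
    using assms by (auto simp: card_2_iff)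
  then show "other A x \<in> A" "other A x \<noteq> x" "other A (other A x) = x"
    by (simp_all add: other_doubleton)
qed

text \<open>The edges and faces around a vertex, with \<open>R = (\<subseteq>)\<close>, and the vertices and edges around a
  face, with \<open>R = (\<in>)\<close>, are both instances of the following pattern.\<close>

definition cyclic :: "('a \<Rightarrow> 'b \<Rightarrow> bool) \<Rightarrow> 'a list \<Rightarrow> 'b list \<Rightarrow> bool" where
  "cyclic R as bs \<longleftrightarrow>
     length as = length bs \<and> 3 \<le> length bs \<and> distinct as \<and> distinct bs \<and>
     (\<forall>i<length bs. {a \<in> set as. R a (bs ! i)} = {as ! i, as ! (Suc i mod length bs)})"

lemma cyclic_rotate1:
  assumes "cyclic R as bs"
  shows "cyclic R (rotate1 as) (rotate1 bs)"
proof -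
  have "Suc i mod length bs < length bs" for i
    using assms by (intro mod_less_divisor) (auto simp: cyclic_def)
  then show ?thesis
    using assms by (simp add: cyclic_def nth_rotate1)
qed

lemma cyclic_rotate:
  assumes "cyclic R as bs"
  shows "cyclic R (rotate k as) (rotate k bs)"
  using assms by (induction k) (simp_all add: cyclic_rotate1)

text \<open>In \<open>cyclic\<close>, \<open>as ! i\<close> comes just before \<open>bs ! i\<close>.
  Read backwards, \<open>bs ! i\<close> is preceded by the element of \<open>as\<close> that used to
  follow it, hence the shift of \<open>as\<close> alone.\<close>

lemma cyclic_reverse:
  assumes "cyclic R as bs"
  shows "cyclic R (rev (rotate1 as)) (rev bs)"
proof -
  let ?n = "length bs"
  have len: "length as = ?n" and n: "3 \<le> ?n"
    using assms by (simp_all add: cyclic_def)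
  have "{a \<in> set as. R a (rev bs ! i)} = {rev (rotate1 as) ! i, rev (rotate1 as) ! (Suc i mod ?n)}"
    if i: "i < ?n" for i
  proof -
    have 1: "rev (rotate1 as) ! j = as ! ((?n - j) mod ?n)" if "j < ?n" for j
      using that by (simp add: rev_nth nth_rotate1 len Suc_diff_Suc)
    have 2: "Suc (?n - Suc i) = ?n - i"
      using i by simp
    have "(?n - Suc i mod ?n) mod ?n = ?n - Suc i"
      using i by (cases "Suc i = ?n") simp_all
    moreover have "Suc i mod ?n < ?n"
      using n by (intro mod_less_divisor) auto
    ultimately have 3: "rev (rotate1 as) ! (Suc i mod ?n) = as ! (?n - Suc i)"
      using 1 by simp
    have "{a \<in> set as. R a (bs ! (?n - Suc i))} = {as ! (?n - Suc i), as ! ((?n - i) mod ?n)}"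
      using assms i n unfolding cyclic_def by (metis 2 diff_less zero_less_Suc less_le_trans zero_less_numeral)
    then show ?thesis
      using 1[OF i] 3 i by (simp add: rev_nth insert_commute)
  qed
  then show ?thesis
    using assms by (simp add: cyclic_def)
qed

lemma cyclic_starting_at:
  assumes cyc: "cyclic R as bs" and "a \<in> set as" "b \<in> set bs" "R a b"
  obtains as' bs' where "cyclic R as' bs'" "as' ! 0 = a" "bs' ! 0 = b"
    "set as' = set as" "set bs' = set bs" "length bs' = length bs"
    "\<exists>k. bs' = rotate k bs \<or> bs' = rotate k (rev bs)"
proof -
  let ?n = "length bs"
  have len: "length as = ?n" and n: "3 \<le> ?n"
    using cyc by (simp_all add: cyclic_def)
  obtain i where i: "i < ?n" "b = bs ! i"
    using assms(3) by (metis in_set_conv_nth)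
  then have "{x \<in> set as. R x b} = {as ! i, as ! (Suc i mod ?n)}"
    using cyc by (simp add: cyclic_def)
  then consider "a = as ! i" | "a = as ! (Suc i mod ?n)"
    using assms by blast
  then show thesis
  proof cases
    case 1
    have "0 < ?n"
      using i by linarith
    then have "rotate i as ! 0 = a" "rotate i bs ! 0 = b"
      using i 1 len nth_rotate[of 0 as i] nth_rotate[of 0 bs i] by simp_all
    then show ?thesis
      using cyclic_rotate[OF cyc, of i] by (intro that[of "rotate i as" "rotate i bs"]) auto
  next
    case 2
    \<comment> \<open>The position of \<open>bs ! i\<close> in \<open>rev bs\<close>.\<close>
    let ?j = "?n - Suc i"
    have j: "Suc (?n - Suc ?j) = Suc i" "?j < ?n" "0 < ?n"
      using i by auto
    have "rotate ?j (rev (rotate1 as)) ! 0 = rev (rotate1 as) ! ?j" "rotate ?j (rev bs) ! 0 = rev bs ! ?j"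
      using nth_rotate[of 0 "rev (rotate1 as)" ?j] nth_rotate[of 0 "rev bs" ?j] j len
      by simp_all
    then have "rotate ?j (rev (rotate1 as)) ! 0 = a" "rotate ?j (rev bs) ! 0 = b"
      using i 2 j len by (simp_all add: rev_nth nth_rotate1)
    then show ?thesis
      using cyclic_rotate[OF cyclic_reverse[OF cyc], of ?j]
      by (intro that[of "rotate ?j (rev (rotate1 as))" "rotate ?j (rev bs)"]) auto
  qed
qed

text \<open>\<open>cyclic\<close> records only which elements of \<open>as\<close> are incident with
  a given \<open>bs ! i\<close>. The third claim is the dual count; it follows from the distinctness
  of \<open>as\<close>, since an index is the successor of one index only.\<close>

lemma cyclic_next:
  assumes cyc: "cyclic R as bs" and i: "i < length bs"
  shows "{a \<in> set as. R a (bs ! i)} = {as ! i, as ! (Suc i mod length bs)}"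
    and "as ! i \<noteq> as ! (Suc i mod length bs)"
    and "{b \<in> set bs. R (as ! (Suc i mod length bs)) b} = {bs ! i, bs ! (Suc i mod length bs)}"
    and "bs ! i \<noteq> bs ! (Suc i mod length bs)"
proof -
  let ?n = "length bs"
  have len: "length as = ?n" and n: "3 \<le> ?n" and d: "distinct as" "distinct bs"
    using cyc by (simp_all add: cyclic_def)
  have a: "{a \<in> set as. R a (bs ! j)} = {as ! j, as ! (Suc j mod ?n)}" if "j < ?n" for j
    using cyc that by (simp add: cyclic_def)
  show "{a \<in> set as. R a (bs ! i)} = {as ! i, as ! (Suc i mod ?n)}"
    using a i .
  let ?k = "Suc i mod ?n"
  have k: "?k < ?n"
    using n by (intro mod_less_divisor) auto
  have ne: "i \<noteq> ?k"
    using n i by (cases "Suc i = ?n") auto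
  show "as ! i \<noteq> as ! ?k" "bs ! i \<noteq> bs ! ?k"
    using d ne i k len by (simp_all add: nth_eq_iff_index_eq)
  have "R (as ! ?k) (bs ! j) \<longleftrightarrow> j = i \<or> j = ?k" if j: "j < ?n" for j
  proof -
    have j': "Suc j mod ?n < ?n"
      using n by (intro mod_less_divisor) auto
    have "R (as ! ?k) (bs ! j) \<longleftrightarrow> as ! ?k \<in> {as ! j, as ! (Suc j mod ?n)}"
      using a[OF j] k len by (metis (mono_tags, lifting) mem_Collect_eq nth_mem)
    also have "\<dots> \<longleftrightarrow> ?k = j \<or> ?k = Suc j mod ?n"
      using d k j j' len by (simp add: nth_eq_iff_index_eq)
    also have "?k = Suc j mod ?n \<longleftrightarrow> i = j"
      using i j by (cases "Suc i = ?n"; cases "Suc j = ?n") auto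
    finally show ?thesis
      by auto
  qed
  then show "{b \<in> set bs. R (as ! ?k) b} = {bs ! i, bs ! ?k}"
    using i k by (auto simp: in_set_conv_nth)
qed

lemma cyclic_card_2:
  assumes cyc: "cyclic R as bs"
  shows "b \<in> set bs \<Longrightarrow> card {a \<in> set as. R a b} = 2"
    and "a \<in> set as \<Longrightarrow> card {b \<in> set bs. R a b} = 2"
proof -
  let ?n = "length bs"
  show "b \<in> set bs \<Longrightarrow> card {a \<in> set as. R a b} = 2"
    using cyclic_next(1,2)[OF cyc] by (auto simp: in_set_conv_nth)
  assume "a \<in> set as"
  then obtain j where j: "j < ?n" "a = as ! j"
    using cyc by (auto simp: in_set_conv_nth cyclic_def)
  have n: "3 \<le> ?n"
    using cyc by (simp add: cyclic_def)
  obtain i where "i < ?n" "Suc i mod ?n = j"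
  proof (cases j)
    case 0
    then show ?thesis
      using n j by (intro that[of "?n - 1"]) (auto simp: Suc_diff_1 simp del: One_nat_def)
  next
    case (Suc i)
    then show ?thesis
      using j by (intro that[of i]) auto
  qed
  then show "card {b \<in> set bs. R a b} = 2"
    using cyclic_next(3,4)[OF cyc, of i] j by simp
qed

text \<open>Common form of both rotations of flags: about a vertex, \<open>(a, b)\<close> is an edge
  with a face; around a face, it is a vertex with an edge.\<close>

definition step_around :: "('a \<Rightarrow> 'b \<Rightarrow> bool) \<Rightarrow> 'a set \<Rightarrow> 'b set \<Rightarrow> 'a \<times> 'b \<Rightarrow> 'a \<times> 'b" where
  "step_around R A B = (\<lambda>(a, b).
     let a' = other {x \<in> A. R x b} a in (a', other {y \<in> B. R a' y} b))"

lemma step_around_funpow: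
  assumes cyc: "cyclic R as bs"
  shows "(step_around R (set as) (set bs) ^^ k) (as ! 0, bs ! 0) =
    (as ! (k mod length bs), bs ! (k mod length bs))"
proof (induction k)
  case (Suc k)
  let ?n = "length bs" and ?i = "k mod length bs"
  have i: "?i < ?n"
    using cyc by (intro mod_less_divisor) (auto simp: cyclic_def)
  show ?case
    using cyclic_next[OF cyc i] Suc.IH
    by (simp add: step_around_def other_doubleton mod_Suc_eq)
qed simp

section \<open>The flags of a map\<close>

locale polyhedral_map =
  fixes S :: "'a topology" and V :: "'a set" and E :: "'a set set"
  assumes is_map: "surface_map S V E"
    and vertex_sequence: "v \<in> V \<Longrightarrow> \<exists>f. has_face_sequence S V E v f \<and> 3 \<le> length f"
begin

abbreviation face_size :: "'a set \<Rightarrow> nat" where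
  "face_size F \<equiv> card {e \<in> E. e \<subseteq> F}"

section \<open>Incidence counts in a map\<close>

lemma finite_edges: "finite E"
  using is_map by (simp add: surface_map_def embedded_graph_def)

lemma edge_meets_vertices:
  assumes "e \<in> E"
  shows "card (e \<inter> V) = 2" and "infinite e"
proof -
  obtain h where e: "e \<subseteq> topspace S" "e \<inter> V = {h 0, h 1}"
    and h: "homeomorphic_map (top_of_set {0..1::real}) (subtopology S e) h"
    using is_map assms by (fastforce simp: surface_map_def embedded_graph_def)
  have inj: "inj_on h {0..1}"
    using homeomorphic_imp_injective_map[OF h] by simp
  have "h ` {0..1} = e"
    using homeomorphic_imp_surjective_map[OF h] e(1) by (simp add: Int_absorb1)
  then show "infinite e"
    using finite_imageD[OF _ inj] infinite_Icc[of "0::real" 1] by auto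
  have "h 0 \<noteq> h 1"
    using inj by (auto dest: inj_onD)
  then show "card (e \<inter> V) = 2"
    using e(2) by simp
qed

lemma edge_inter:
  assumes "e \<in> E" "e' \<in> E" "e \<noteq> e'"
  shows "e \<inter> e' \<subseteq> V"
  using is_map assms by (simp add: surface_map_def embedded_graph_def)

text \<open>A face is its open disk together with the boundary cycle, and the disk misses the graph.
  So the cycle contains all vertices and edges in \<open>F\<close>, and \<open>p\<close> is
  determined by \<open>F\<close>.\<close>

lemma polygonal_face_cycle:
  assumes "polygonal_face S V E p F"
  obtains vs es where "length es = p" "cyclic (\<in>) vs es"
    "set vs = {v \<in> V. v \<in> F}" "set es = {e \<in> E. e \<subseteq> F}"
proof -
  obtain C h where C: "C \<in> open_faces S V E" "F = S closure_of C"
    and h: "homeomorphic_map (top_of_set (cball (0::complex) 1)) (subtopology S F) h" "h ` ball 0 1 = C"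
    and B: "graph_cycle V E p (h ` sphere 0 1)"
    using assms unfolding polygonal_face_def by blast
  obtain vs es where vs: "length vs = p" "distinct vs" "set vs \<subseteq> V"
    and es: "length es = p" "distinct es" "set es \<subseteq> E" and p: "3 \<le> p"
    and incs: "\<forall>i<p. es ! i \<inter> V = {vs ! i, vs ! (Suc i mod p)}"
    and B_eq: "h ` sphere 0 1 = \<Union>(set es)"
    using B unfolding graph_cycle_def by (elim exE conjE) (rule that)
  have inc: "es ! i \<inter> V = {vs ! i, vs ! (Suc i mod p)}" if "i < p" for i
    using incs that by blast
  have "F \<subseteq> topspace S"
    by (simp add: C(2) closure_of_subset_topspace)
  then have "F = h ` cball 0 1"
    using homeomorphic_imp_surjective_map[OF h(1)] by (simp add: Int_absorb1)
  also have "cball (0::complex) 1 = ball 0 1 \<union> sphere 0 1"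
    by auto
  finally have F: "F = C \<union> \<Union>(set es)"
    by (simp only: image_Un h(2) B_eq)
  have "C \<subseteq> topspace (subtopology S (topspace S - graph_points V E))"
    using C(1) unfolding open_faces_def by (rule connected_components_of_subset)
  then have disj: "C \<inter> V = {}" "C \<inter> \<Union>E = {}"
    by (auto simp: graph_points_def)
  have in_vs: "vs ! (Suc i mod p) \<in> set vs" if "i < p" for i
    using vs(1) p by (metis less_le_trans mod_less_divisor nth_mem zero_less_numeral)
  have "set es = {e \<in> E. e \<subseteq> F}"
  proof (intro equalityI subsetI)
    fix e assume "e \<in> set es"
    then show "e \<in> {e \<in> E. e \<subseteq> F}"
      using F es(3) by blast
  next
    fix e assume "e \<in> {e \<in> E. e \<subseteq> F}"
    then have e: "e \<in> E" "e \<subseteq> \<Union>(set es)"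
      using F disj by blast+
    \<comment> \<open>An edge outside the cycle would be covered by its intersections with the edges
      of the cycle, hence consist of finitely many vertices, although an arc is infinite.\<close>
    show "e \<in> set es"
    proof (rule ccontr)
      assume "e \<notin> set es"
      then have "e \<inter> e' \<subseteq> V" if "e' \<in> set es" for e'
        using edge_inter[OF e(1)] es(3) that by blast
      then have "e \<subseteq> e \<inter> V"
        using e(2) by blast
      moreover have "finite (e \<inter> V)"
        using edge_meets_vertices(1)[OF e(1)] by (simp add: card_ge_0_finite)
      ultimately show False
        using edge_meets_vertices(2)[OF e(1)] finite_subset by blast
    qed
  qed
  moreover have "set vs = {v \<in> V. v \<in> F}"
  proof (intro equalityI subsetI)
    fix v assume "v \<in> set vs"
    then obtain i where i: "i < p" "v = vs ! i"
      using vs(1) by (metis in_set_conv_nth)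
    then have "v \<in> es ! i" "es ! i \<in> set es"
      using inc[OF i(1)] es(1) by auto
    then show "v \<in> {v \<in> V. v \<in> F}"
      using \<open>v \<in> set vs\<close> vs(3) F by blast
  next
    fix v assume "v \<in> {v \<in> V. v \<in> F}"
    then obtain e where "v \<in> V" "e \<in> set es" "v \<in> e"
      using F disj by blast
    then obtain i where i: "i < p" "v \<in> es ! i \<inter> V"
      using es(1) by (metis IntI in_set_conv_nth)
    then have "v = vs ! i \<or> v = vs ! (Suc i mod p)"
      using inc[OF i(1)] by blast
    then show "v \<in> set vs"
      using in_vs[OF i(1)] i(1) vs(1) by (metis nth_mem)
  qed
  moreover have "{v \<in> set vs. v \<in> es ! i} = {vs ! i, vs ! (Suc i mod p)}" if "i < p" for i
  proof -
    have "vs ! i \<in> set vs"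
      using vs(1) that by simp
    then show ?thesis
      using inc[OF that] in_vs[OF that] vs(3) by blast
  qed
  then have "cyclic (\<in>) vs es"
    using vs es p by (simp add: cyclic_def)
  ultimately show thesis
    using es(1) that by blast
qed

lemma polygonal_face_size:
  assumes "polygonal_face S V E p F"
  shows "p = face_size F"
proof -
  obtain vs es where "length es = p" "cyclic (\<in>) vs es" "set es = {e \<in> E. e \<subseteq> F}"
    using assms by (rule polygonal_face_cycle)
  then show ?thesis
    using distinct_card[of es] by (simp add: cyclic_def)
qed

lemma face_cycle:
  assumes "F \<in> faces S V E"
  obtains vs es where "cyclic (\<in>) vs es" "set vs = {v \<in> V. v \<in> F}" "set es = {e \<in> E. e \<subseteq> F}"
proof -
  obtain p where "polygonal_face S V E p F"
    using is_map assms unfolding surface_map_def by blast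
  then show thesis
    using polygonal_face_cycle that by metis
qed

lemma face_corner:
  assumes "F \<in> faces S V E" "v \<in> V" "v \<in> F"
  shows "card {e \<in> E. v \<in> e \<and> e \<subseteq> F} = 2"
proof -
  obtain vs es where cyc: "cyclic (\<in>) vs es" "set vs = {v \<in> V. v \<in> F}" "set es = {e \<in> E. e \<subseteq> F}"
    using assms(1) by (rule face_cycle)
  have "{e \<in> E. v \<in> e \<and> e \<subseteq> F} = {e \<in> set es. v \<in> e}"
    using cyc(3) by blast
  then show ?thesis
    using cyclic_card_2(2)[OF cyc(1)] cyc(2) assms by simp
qed

text \<open>A face-sequence names two edges at \<open>v\<close> in each \<open>Fs ! i\<close>; by
  \<open>face_corner\<close> there are no others.\<close>

lemma vertex_cycle:
  assumes "v \<in> V" and f: "has_face_sequence S V E v f" "3 \<le> length f"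
  obtains es Fs where "cyclic (\<subseteq>) es Fs" "set es = {e \<in> E. v \<in> e}"
    "set Fs = {F \<in> faces S V E. v \<in> F}" "f = map face_size Fs"
proof -
  let ?n = "length f"
  obtain es Fs where es: "length es = ?n" "distinct es" "set es = {e \<in> E. v \<in> e}"
    and Fs: "length Fs = ?n" "distinct Fs" "set Fs = {F \<in> faces S V E. v \<in> F}"
    and incs: "\<forall>i<?n. es ! i \<subseteq> Fs ! i \<and> es ! (Suc i mod ?n) \<subseteq> Fs ! i \<and>
      polygonal_face S V E (f ! i) (Fs ! i)"
    using f(1) unfolding has_face_sequence_def by (elim exE conjE) (rule that)
  have inc: "es ! i \<subseteq> Fs ! i" "es ! (Suc i mod ?n) \<subseteq> Fs ! i"
      "polygonal_face S V E (f ! i) (Fs ! i)" if "i < ?n" for i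
    using incs that by blast+
  have "{e \<in> set es. e \<subseteq> Fs ! i} = {es ! i, es ! (Suc i mod ?n)}" if i: "i < ?n" for i
  proof -
    have k: "Suc i mod ?n < ?n"
      using f(2) by (intro mod_less_divisor) auto
    have "i \<noteq> Suc i mod ?n"
      using f(2) i by (cases "Suc i = ?n") auto
    then have "card {es ! i, es ! (Suc i mod ?n)} = 2"
      using es i k by (simp add: nth_eq_iff_index_eq)
    moreover have "{es ! i, es ! (Suc i mod ?n)} \<subseteq> {e \<in> set es. e \<subseteq> Fs ! i}"
      using inc i k es(1) by simp
    moreover have "{e \<in> set es. e \<subseteq> Fs ! i} = {e \<in> E. v \<in> e \<and> e \<subseteq> Fs ! i}"
      using es(3) by blast
    moreover have "Fs ! i \<in> faces S V E" "v \<in> Fs ! i"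
      using Fs i nth_mem[of i Fs] by auto
    ultimately have "card {es ! i, es ! (Suc i mod ?n)} = card {e \<in> set es. e \<subseteq> Fs ! i}"
      "{es ! i, es ! (Suc i mod ?n)} \<subseteq> {e \<in> set es. e \<subseteq> Fs ! i}"
      using face_corner[of "Fs ! i" v] assms(1) by simp_all
    then show ?thesis
      by (intro card_subset_eq[symmetric]) auto
  qed
  then have "cyclic (\<subseteq>) es Fs"
    using es Fs f(2) by (simp add: cyclic_def)
  moreover have "f = map face_size Fs"
    using inc(3) polygonal_face_size Fs(1) by (intro nth_equalityI) auto
  ultimately show thesis
    using es Fs that by blast
qed

text \<open>Every face containing \<open>e\<close> contains an end \<open>v\<close> of it, so it
  occurs in the cyclic list at \<open>v\<close>, where each edge lies in exactly two faces.\<close>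

lemma edge_faces:
  assumes "e \<in> E"
  shows "card {F \<in> faces S V E. e \<subseteq> F} = 2"
proof -
  have "e \<inter> V \<noteq> {}"
    using edge_meets_vertices(1)[OF assms] by auto
  then obtain v where v: "v \<in> V" "v \<in> e"
    by blast
  obtain f where f: "has_face_sequence S V E v f" "3 \<le> length f"
    using vertex_sequence v(1) by blast
  obtain es Fs where cyc: "cyclic (\<subseteq>) es Fs" "set es = {e \<in> E. v \<in> e}"
    "set Fs = {F \<in> faces S V E. v \<in> F}"
    using v(1) f by (rule vertex_cycle)
  have "{F \<in> faces S V E. e \<subseteq> F} = {F \<in> set Fs. e \<subseteq> F}"
    using cyc(3) v(2) by blast
  then show ?thesis
    using cyclic_card_2(2)[OF cyc(1)] cyc(2) assms v(2) by simp
qed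

lemma vertex_in_edge:
  assumes "v \<in> V"
  obtains e where "e \<in> E" "v \<in> e"
proof -
  obtain f where f: "has_face_sequence S V E v f" "3 \<le> length f"
    using vertex_sequence assms by blast
  obtain es Fs where "cyclic (\<subseteq>) es Fs" "set es = {e \<in> E. v \<in> e}"
    using assms f by (rule vertex_cycle)
  moreover from this have "es \<noteq> []"
    by (auto simp: cyclic_def)
  ultimately show thesis
    using that hd_in_set by blast
qed

lemma edge_in_face:
  assumes "e \<in> E"
  obtains F where "F \<in> faces S V E" "e \<subseteq> F"
  using edge_faces[OF assms] that by (metis (mono_tags, lifting) card.empty empty_Collect_eq zero_neq_numeral)

section \<open>Flags and their involutions\<close>

definition flags :: "('a \<times> 'a set \<times> 'a set) set" where
  "flags = {(v, e, F). v \<in> V \<and> e \<in> E \<and> F \<in> faces S V E \<and> v \<in> e \<and> e \<subseteq> F}"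

definition change_vertex :: "'a \<times> 'a set \<times> 'a set \<Rightarrow> 'a \<times> 'a set \<times> 'a set" where
  "change_vertex = (\<lambda>(v, e, F). (other (e \<inter> V) v, e, F))"

definition change_edge :: "'a \<times> 'a set \<times> 'a set \<Rightarrow> 'a \<times> 'a set \<times> 'a set" where
  "change_edge = (\<lambda>(v, e, F). (v, other {e' \<in> E. v \<in> e' \<and> e' \<subseteq> F} e, F))"

definition change_face :: "'a \<times> 'a set \<times> 'a set \<Rightarrow> 'a \<times> 'a set \<times> 'a set" where
  "change_face = (\<lambda>(v, e, F). (v, e, other {F' \<in> faces S V E. e \<subseteq> F'} F))"

definition flag_size :: "'a \<times> 'a set \<times> 'a set \<Rightarrow> nat" where
  "flag_size = (\<lambda>(v, e, F). face_size F)"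

definition flag_degree :: "'a \<times> 'a set \<times> 'a set \<Rightarrow> nat" where
  "flag_degree = (\<lambda>(v, e, F). card {e \<in> E. v \<in> e})"

lemma change_vertex_flag:
  assumes "\<phi> \<in> flags"
  shows "change_vertex \<phi> \<in> flags" "change_vertex (change_vertex \<phi>) = \<phi>"
proof -
  obtain v e F where "\<phi> = (v, e, F)" "v \<in> V" "e \<in> E" "F \<in> faces S V E" "v \<in> e" "e \<subseteq> F"
    using assms by (auto simp: flags_def)
  then show "change_vertex \<phi> \<in> flags" "change_vertex (change_vertex \<phi>) = \<phi>"
    using other_card_2[OF edge_meets_vertices(1)[of e], of v]
    by (auto simp: flags_def change_vertex_def)
qed

lemma change_edge_flag:
  assumes "\<phi> \<in> flags"
  shows "change_edge \<phi> \<in> flags" "change_edge (change_edge \<phi>) = \<phi>"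
proof -
  obtain v e F where "\<phi> = (v, e, F)" "v \<in> V" "e \<in> E" "F \<in> faces S V E" "v \<in> e" "e \<subseteq> F"
    using assms by (auto simp: flags_def)
  then show "change_edge \<phi> \<in> flags" "change_edge (change_edge \<phi>) = \<phi>"
    using other_card_2[OF face_corner[of F v], of e]
    by (auto simp: flags_def change_edge_def)
qed

lemma change_face_flag:
  assumes "\<phi> \<in> flags"
  shows "change_face \<phi> \<in> flags" "change_face (change_face \<phi>) = \<phi>"
proof -
  obtain v e F where "\<phi> = (v, e, F)" "v \<in> V" "e \<in> E" "F \<in> faces S V E" "v \<in> e" "e \<subseteq> F"
    using assms by (auto simp: flags_def)
  then show "change_face \<phi> \<in> flags" "change_face (change_face \<phi>) = \<phi>"
    using other_card_2[OF edge_faces[of e], of F]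
    by (auto simp: flags_def change_face_def)
qed

lemma rotate_about_vertex:
  assumes "(v, e, F) \<in> flags"
  shows "((\<lambda>\<phi>. change_face (change_edge \<phi>)) ^^ k) (v, e, F) =
      (v, (step_around (\<subseteq>) {e \<in> E. v \<in> e} {F \<in> faces S V E. v \<in> F} ^^ k) (e, F))
    \<and> ((\<lambda>\<phi>. change_face (change_edge \<phi>)) ^^ k) (v, e, F) \<in> flags"
proof (induction k)
  case (Suc k)
  let ?g = "step_around (\<subseteq>) {e \<in> E. v \<in> e} {F \<in> faces S V E. v \<in> F}"
  obtain e' F' where g: "(?g ^^ k) (e, F) = (e', F')"
    by (cases "(?g ^^ k) (e, F)") auto
  then have fl: "((\<lambda>\<phi>. change_face (change_edge \<phi>)) ^^ k) (v, e, F) = (v, e', F')" "(v, e', F') \<in> flags"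
    using Suc.IH by auto
  define e'' where "e'' = other {e \<in> E. v \<in> e \<and> e \<subseteq> F'} e'"
  have "(v, e'', F') \<in> flags"
    using change_edge_flag(1)[OF fl(2)] by (simp add: change_edge_def e''_def)
  \<comment> \<open>All faces through \<open>e''\<close> contain \<open>v\<close>, so
    \<open>change_face\<close> and \<open>step_around\<close> choose from the same two
    faces.\<close>
  then have "{F \<in> {F \<in> faces S V E. v \<in> F}. e'' \<subseteq> F} = {F \<in> faces S V E. e'' \<subseteq> F}"
    by (auto simp: flags_def)
  moreover have "{e \<in> {e \<in> E. v \<in> e}. e \<subseteq> F'} = {e \<in> E. v \<in> e \<and> e \<subseteq> F'}"
    by blast
  ultimately have "change_face (change_edge (v, e', F')) = (v, ?g (e', F'))"
    by (simp add: change_face_def change_edge_def step_around_def e''_def[symmetric])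
  moreover have "change_face (change_edge (v, e', F')) \<in> flags"
    using fl(2) by (simp add: change_edge_flag change_face_flag)
  ultimately show ?case
    using fl g by simp
qed (use assms in simp)

lemma rotate_about_face:
  assumes "(v, e, F) \<in> flags"
  shows "((\<lambda>\<phi>. change_edge (change_vertex \<phi>)) ^^ k) (v, e, F) =
      (case (step_around (\<in>) {v \<in> V. v \<in> F} {e \<in> E. e \<subseteq> F} ^^ k) (v, e) of (v', e') \<Rightarrow> (v', e', F))
    \<and> ((\<lambda>\<phi>. change_edge (change_vertex \<phi>)) ^^ k) (v, e, F) \<in> flags"
proof (induction k)
  case (Suc k)
  let ?g = "step_around (\<in>) {v \<in> V. v \<in> F} {e \<in> E. e \<subseteq> F}"
  obtain v' e' where g: "(?g ^^ k) (v, e) = (v', e')"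
    by (cases "(?g ^^ k) (v, e)") auto
  then have fl: "((\<lambda>\<phi>. change_edge (change_vertex \<phi>)) ^^ k) (v, e, F) = (v', e', F)" "(v', e', F) \<in> flags"
    using Suc.IH by auto
  have "{v \<in> {v \<in> V. v \<in> F}. v \<in> e'} = e' \<inter> V"
    using fl(2) by (auto simp: flags_def)
  moreover have "{e \<in> {e \<in> E. e \<subseteq> F}. u \<in> e} = {e \<in> E. u \<in> e \<and> e \<subseteq> F}" for u
    by blast
  ultimately have "change_edge (change_vertex (v', e', F)) = (case ?g (v', e') of (v', e') \<Rightarrow> (v', e', F))"
    by (simp add: change_vertex_def change_edge_def step_around_def Let_def)
  moreover have "change_edge (change_vertex (v', e', F)) \<in> flags"
    using fl(2) by (simp add: change_edge_flag change_vertex_flag)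
  ultimately show ?case
    using fl g by simp
qed (use assms in simp)

lemma vertex_cycle_at:
  assumes "(v, e, F) \<in> flags" and f: "has_face_sequence S V E v f" "3 \<le> length f"
  obtains Fs where "flag_degree (v, e, F) = length Fs"
    "\<forall>k. flag_size (((\<lambda>\<phi>. change_face (change_edge \<phi>)) ^^ k) (v, e, F)) =
      face_size (Fs ! (k mod length Fs))"
    "((\<lambda>\<phi>. change_face (change_edge \<phi>)) ^^ length Fs) (v, e, F) = (v, e, F)"
    "same_face_sequence f (map face_size Fs)"
proof -
  have v: "v \<in> V" "e \<in> E" "F \<in> faces S V E" "v \<in> e" "e \<subseteq> F"
    using assms(1) by (auto simp: flags_def)
  obtain es Fs where cyc: "cyclic (\<subseteq>) es Fs" "set es = {e \<in> E. v \<in> e}"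
    "set Fs = {F \<in> faces S V E. v \<in> F}" "f = map face_size Fs"
    using v(1) f by (rule vertex_cycle)
  have "e \<in> set es" "F \<in> set Fs"
    using cyc(2,3) v by auto
  then obtain es' Fs' where cyc': "cyclic (\<subseteq>) es' Fs'" "es' ! 0 = e" "Fs' ! 0 = F"
    "set es' = set es" "set Fs' = set Fs" "length Fs' = length Fs"
    "\<exists>k. Fs' = rotate k Fs \<or> Fs' = rotate k (rev Fs)"
    using v(5) by (rule cyclic_starting_at[OF cyc(1)])
  have pow: "((\<lambda>\<phi>. change_face (change_edge \<phi>)) ^^ k) (v, e, F) =
      (v, es' ! (k mod length Fs'), Fs' ! (k mod length Fs'))" for k
    using rotate_about_vertex[OF assms(1), of k] step_around_funpow[OF cyc'(1), of k] cyc cyc'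
    by simp
  show thesis
  proof (rule that[of Fs'])
    have "flag_degree (v, e, F) = card (set es')"
      using cyc(2) cyc'(4) by (simp add: flag_degree_def)
    then show "flag_degree (v, e, F) = length Fs'"
      using cyc'(1) by (simp add: cyclic_def distinct_card)
    show "\<forall>k. flag_size (((\<lambda>\<phi>. change_face (change_edge \<phi>)) ^^ k) (v, e, F)) =
      face_size (Fs' ! (k mod length Fs'))"
      unfolding pow by (simp add: flag_size_def)
    show "((\<lambda>\<phi>. change_face (change_edge \<phi>)) ^^ length Fs') (v, e, F) = (v, e, F)"
      unfolding pow by (simp add: cyc'(2,3))
    show "same_face_sequence f (map face_size Fs')"
      using cyc'(7) unfolding same_face_sequence_def cyc(4)
      by (auto simp: rotate_map rev_map)
  qed
qed

sublocale flag_system flags change_vertex change_edge change_face flag_size flag_degree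
proof
  fix \<phi> assume \<phi>: "\<phi> \<in> flags"
  then obtain v e F where vef: "\<phi> = (v, e, F)" "v \<in> V" "e \<in> E" "F \<in> faces S V E" "v \<in> e" "e \<subseteq> F"
    by (auto simp: flags_def)
  show "change_vertex \<phi> \<in> flags" "change_edge \<phi> \<in> flags" "change_face \<phi> \<in> flags"
    "change_vertex (change_vertex \<phi>) = \<phi>" "change_edge (change_edge \<phi>) = \<phi>"
    "change_face (change_face \<phi>) = \<phi>"
    using \<phi> by (simp_all add: change_vertex_flag change_edge_flag change_face_flag)
  show "change_vertex (change_face \<phi>) = change_face (change_vertex \<phi>)"
    "flag_size (change_vertex \<phi>) = flag_size \<phi>" "flag_size (change_edge \<phi>) = flag_size \<phi>"
    "flag_degree (change_edge \<phi>) = flag_degree \<phi>" "flag_degree (change_face \<phi>) = flag_degree \<phi>"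
    by (simp_all add: vef change_vertex_def change_edge_def change_face_def flag_size_def flag_degree_def)
  show "0 < flag_size \<phi>" "0 < flag_degree \<phi>"
    using vef finite_edges by (auto simp: flag_size_def flag_degree_def card_gt_0_iff)
  obtain f where f: "has_face_sequence S V E v f" "3 \<le> length f"
    using vertex_sequence vef(2) by blast
  show "((\<lambda>\<phi>. change_face (change_edge \<phi>)) ^^ flag_degree \<phi>) \<phi> = \<phi>"
    using \<phi>[unfolded vef(1)] f by (rule vertex_cycle_at) (simp only: vef(1))
  obtain vs es where cyc: "cyclic (\<in>) vs es" "set vs = {v \<in> V. v \<in> F}" "set es = {e \<in> E. e \<subseteq> F}"
    using vef(4) by (rule face_cycle)
  have "v \<in> set vs" "e \<in> set es"
    using cyc(2,3) vef by auto
  then obtain vs' es' where cyc': "cyclic (\<in>) vs' es'" "vs' ! 0 = v" "es' ! 0 = e"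
    "set vs' = set vs" "set es' = set es"
    using vef(5) by (rule cyclic_starting_at[OF cyc(1)])
  have "flag_size \<phi> = length es'"
    using cyc(3) cyc'(1,5) distinct_card[of es'] by (simp add: vef(1) flag_size_def cyclic_def)
  then show "((\<lambda>\<phi>. change_edge (change_vertex \<phi>)) ^^ flag_size \<phi>) \<phi> = \<phi>"
    using rotate_about_face[of v e F "length es'"] step_around_funpow[OF cyc'(1), of "length es'"] \<phi>
      cyc cyc' by (simp add: vef(1))
qed

text \<open>As the view depends on the flag alone, any two face-sequences of one vertex are
  equivalent.\<close>

lemma same_face_sequence_view:
  assumes "(v, e, F) \<in> flags" and f: "has_face_sequence S V E v f" "3 \<le> length f"
  shows "same_face_sequence f (view (v, e, F))"
proof -
  obtain Fs where Fs: "flag_degree (v, e, F) = length Fs"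
    "\<forall>k. flag_size (((\<lambda>\<phi>. change_face (change_edge \<phi>)) ^^ k) (v, e, F)) =
      face_size (Fs ! (k mod length Fs))"
    "((\<lambda>\<phi>. change_face (change_edge \<phi>)) ^^ length Fs) (v, e, F) = (v, e, F)"
    "same_face_sequence f (map face_size Fs)"
    using assms by (rule vertex_cycle_at)
  have "view (v, e, F) = map face_size Fs"
    by (rule nth_equalityI) (simp_all add: view_def Fs(1,2))
  then show ?thesis
    using Fs(4) by simp
qed

lemma flag_at_vertex:
  assumes "v \<in> V"
  obtains e F where "(v, e, F) \<in> flags"
  using assms vertex_in_edge edge_in_face unfolding flags_def
  by (metis (mono_tags, lifting) case_prodI mem_Collect_eq)

text \<open>If no edge left \<open>W\<close>, following boundary cycles would place the vertices of
  each face all inside or all outside \<open>W\<close>. The unions of the faces of either kind would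
  be closed, nonempty and cover \<open>S\<close>; they would be disjoint because distinct faces that
  meet share a vertex.\<close>

lemma connected_vertices:
  assumes "connected_space S" and W: "W \<subseteq> V" "W \<noteq> {}" "W \<noteq> V"
  obtains e u v where "e \<in> E" "u \<in> e \<inter> W" "v \<in> e \<inter> (V - W)"
proof (rule ccontr)
  assume "\<not> thesis"
  then have "\<forall>e\<in>E. \<not> (\<exists>u v. u \<in> e \<inter> W \<and> v \<in> e \<inter> (V - W))"
    using that by blast
  then have edge: "e \<inter> V \<subseteq> W \<or> e \<inter> W = {}" if "e \<in> E" for e
    using that by blast
  have face: "F \<inter> V \<subseteq> W \<or> F \<inter> W = {}" if F: "F \<in> faces S V E" for F
  proof -
    obtain vs es where cyc: "cyclic (\<in>) vs es" "set vs = {v \<in> V. v \<in> F}" "set es = {e \<in> E. e \<subseteq> F}"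
      using F by (rule face_cycle)
    have same: "vs ! i \<in> W \<longleftrightarrow> vs ! 0 \<in> W" if "i < length es" for i
      using that
    proof (induction i)
      case (Suc i)
      have i: "i < length es" "Suc i mod length es = Suc i"
        using Suc.prems by simp_all
      have "{vs ! i, vs ! Suc i} \<subseteq> es ! i \<inter> V" "es ! i \<in> E"
        using cyclic_next(1)[OF cyc(1) i(1)] cyc(2,3) i nth_mem[OF i(1)] by auto
      then show ?case
        using edge[of "es ! i"] Suc.IH i by auto
    qed simp
    show ?thesis
    proof (cases "vs ! 0 \<in> W")
      case True
      then have "set vs \<subseteq> W"
        using same cyc(1) by (auto simp: in_set_conv_nth cyclic_def)
      then show ?thesis
        using cyc(2) by blast
    next
      case False
      then have "set vs \<inter> W = {}"
        using same cyc(1) by (auto simp: in_set_conv_nth cyclic_def)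
      then show ?thesis
        using cyc(2) W(1) by blast
    qed
  qed
  have vertex_face: "\<exists>F\<in>faces S V E. v \<in> F" if "v \<in> V" for v
    by (rule flag_at_vertex[OF that]) (auto simp: flags_def)
  \<comment> \<open>Each face contains one of the finitely many vertices, and each vertex lies in
    finitely many faces. Finiteness is what makes the two unions closed.\<close>
  have "finite (faces S V E)"
  proof -
    have "finite {F \<in> faces S V E. v \<in> F}" if "v \<in> V" for v
      using vertex_sequence[OF that] unfolding has_face_sequence_def by (metis List.finite_set)
    moreover have "finite V"
      using is_map by (simp add: surface_map_def embedded_graph_def)
    moreover have "faces S V E \<subseteq> (\<Union>v\<in>V. {F \<in> faces S V E. v \<in> F})"
    proof
      fix F assume F: "F \<in> faces S V E"
      obtain vs es where "cyclic (\<in>) vs es" "set vs = {v \<in> V. v \<in> F}"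
        using F by (rule face_cycle)
      moreover from this have "vs \<noteq> []"
        by (auto simp: cyclic_def)
      ultimately show "F \<in> (\<Union>v\<in>V. {F \<in> faces S V E. v \<in> F})"
        using F hd_in_set by blast
    qed
    ultimately show ?thesis
      by (meson finite_UN_I finite_subset)
  qed
  define A where "A = \<Union>{F \<in> faces S V E. F \<inter> W \<noteq> {}}"
  define B where "B = \<Union>{F \<in> faces S V E. F \<inter> W = {}}"
  have "closedin S F" if "F \<in> faces S V E" for F
    using that by (auto simp: faces_def)
  then have "closedin S A" "closedin S B"
    unfolding A_def B_def using \<open>finite (faces S V E)\<close> by (auto intro!: closedin_Union)
  moreover have "topspace S \<subseteq> A \<union> B"
  proof
    fix x assume x: "x \<in> topspace S"
    have "\<exists>F\<in>faces S V E. x \<in> F"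
    proof (cases "x \<in> graph_points V E")
      case True
      then show ?thesis
        using vertex_face edge_in_face unfolding graph_points_def by (metis UnE UnionE subsetD)
    next
      case False
      then have "x \<in> \<Union>(open_faces S V E)"
        using x by (simp add: open_faces_def Union_connected_components_of)
      then obtain C where C: "C \<in> open_faces S V E" "x \<in> C"
        by blast
      then have "x \<in> S closure_of C"
        using x by (auto simp: in_closure_of)
      then show ?thesis
        using C(1) by (auto simp: faces_def)
    qed
    then show "x \<in> A \<union> B"
      unfolding A_def B_def by blast
  qed
  moreover have "A \<inter> B = {}"
  proof (rule ccontr)
    assume "A \<inter> B \<noteq> {}"
    then obtain F F' where F: "F \<in> faces S V E" "F \<inter> W \<noteq> {}" "F' \<in> faces S V E" "F' \<inter> W = {}"
      "F \<inter> F' \<noteq> {}"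
      unfolding A_def B_def by blast
    moreover have "F \<noteq> F'"
      using F by blast
    ultimately have "(\<exists>v\<in>V. F \<inter> F' = {v}) \<or> F \<inter> F' \<in> E"
      using is_map unfolding surface_map_def by blast
    moreover have "e \<inter> V \<noteq> {}" if "e \<in> E" for e
      using edge_meets_vertices(1)[OF that] by auto
    ultimately have "F \<inter> F' \<inter> V \<noteq> {}"
      by blast
    then show False
      using face[OF F(1)] F by blast
  qed
  moreover have "A \<noteq> {}"
    using vertex_face W(1,2) unfolding A_def by blast
  moreover have "B \<noteq> {}"
  proof -
    obtain v where v: "v \<in> V" "v \<notin> W"
      using W by blast
    then obtain F where "F \<in> faces S V E" "v \<in> F"
      using vertex_face by blast
    then show ?thesis
      using face[of F] v unfolding B_def by blast
  qed
  ultimately show False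
    using assms(1) unfolding connected_space_closedin by blast
qed

end

section \<open>Pairs of face-sequences\<close>

definition realizable_pairs :: "(nat list \<times> nat list) list" where
  "realizable_pairs =
     [([3,3,3,3,3,3], [3,3,3,3,6]), ([3,3,3,3,3,3], [3,3,3,4,4]), ([3,3,3,3,3,3], [3,3,4,3,4]),
      ([3,3,3,3,3,3], [3,3,4,12]), ([3,3,3,3,3,3], [3,3,6,6]), ([3,3,3,3,6], [3,6,3,6]),
      ([3,3,3,4,4], [3,3,4,3,4]), ([3,3,3,4,4], [3,4,6,4]), ([3,3,3,4,4], [4,4,4,4]),
      ([3,3,4,3,4], [3,4,6,4]), ([3,3,6,6], [3,3,3,3,6]), ([3,3,6,6], [3,6,3,6]),
      ([3,4,4,6], [3,4,6,4]), ([3,4,4,6], [3,6,3,6]), ([3,4,6,4], [4,6,12]),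
      ([3,12,12], [3,4,3,12])]"

definition unrealizable_pairs :: "(nat list \<times> nat list) list" where
  "unrealizable_pairs =
     [([3,3,3,3,6], [3,3,3,4,4]), ([3,3,3,3,6], [3,3,4,3,4]), ([3,3,3,3,6], [3,3,4,12]),
      ([3,3,3,3,6], [3,4,4,6]), ([3,3,3,4,4], [3,3,4,12]), ([3,3,3,4,4], [3,4,3,12]),
      ([3,3,3,4,4], [3,3,6,6]), ([3,3,3,4,4], [3,4,4,6]), ([3,3,4,3,4], [3,3,4,12]),
      ([3,3,4,3,4], [3,4,3,12]), ([3,3,4,3,4], [3,3,6,6]), ([3,3,4,3,4], [3,4,4,6]),
      ([3,3,4,12], [3,4,3,12]), ([3,3,4,12], [3,3,6,6]), ([3,3,4,12], [3,4,4,6]),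
      ([3,3,4,12], [3,4,6,4]), ([3,3,4,12], [3,12,12]), ([3,3,4,12], [4,6,12]),
      ([3,4,3,12], [3,4,4,6]), ([3,4,3,12], [3,4,6,4]), ([3,3,6,6], [3,4,4,6]),
      ([3,3,6,6], [6,6,6]), ([3,4,4,6], [4,4,4,4]), ([3,4,4,6], [4,6,12])]"

lemma share_edge_flat_types:
  "list_all (\<lambda>f. list_all (\<lambda>g.
     if share_edge f g
     then f = g \<or> (f, g) \<in> set (realizable_pairs @ unrealizable_pairs)
       \<or> (g, f) \<in> set (realizable_pairs @ unrealizable_pairs)
     else True) flat_types) flat_types"
  by code_simp

text \<open>A typical obstruction, for \<open>([3,3,6,6], [6,6,6])\<close>: all vertices of a
  triangle have the first type, so its sides border alternately a triangle and a hexagon, which is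
  impossible around three sides.\<close>

lemma incompatible_unrealizable_pairs:
  "\<forall>(f, g) \<in> set unrealizable_pairs. \<not> compatible f g"
  unfolding unrealizable_pairs_def list.set ball_simps prod.case
  by (intro conjI TrueI; code_simp)

lemma compatible_flat_types:
  assumes "f \<in> set flat_types" "g \<in> set flat_types" "f \<noteq> g"
    and "share_edge f g" "compatible f g" "compatible g f"
  shows "(f, g) \<in> set realizable_pairs \<or> (g, f) \<in> set realizable_pairs"
  using share_edge_flat_types incompatible_unrealizable_pairs assms
  unfolding list_all_iff set_append by (metis (no_types, lifting) UnE case_prodD)

lemma connected_torus_or_klein_bottle:
  assumes "torus S \<or> klein_bottle S"
  shows "connected_space S"
  using assms
proof
  assume "torus S"
  moreover have "connected (sphere (0::complex) 1 \<times> sphere (0::complex) 1)"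
    by (intro connected_Times) (simp_all add: connected_sphere_eq)
  then have "connected_space (top_of_set (sphere (0::complex) 1 \<times> sphere (0::complex) 1))"
    by (simp add: connectedin_def flip: connectedin_iff_connected)
  ultimately show ?thesis
    unfolding torus_def by (simp add: homeomorphic_connected_space)
next
  assume "klein_bottle S"
  moreover have "connected_space (euclidean :: (real \<times> real) topology)"
    by (simp add: convex_connected flip: connectedin_topspace)
  ultimately show ?thesis
    unfolding klein_bottle_def using connected_space_quotient_map_image by blast
qed

lemma polygonal_face_ge_3: "polygonal_face S V E p F \<Longrightarrow> 3 \<le> p"
  by (auto simp: polygonal_face_def graph_cycle_def)

lemma has_face_sequence_ge_3:
  assumes "has_face_sequence S V E v f"
  shows "\<forall>p\<in>set f. 3 \<le> p"
  using assms unfolding has_face_sequence_def by (metis in_set_conv_nth polygonal_face_ge_3)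

lemma has_face_sequence_length:
  assumes "has_face_sequence S V E v f"
  shows "length f = card {e \<in> E. v \<in> e}"
  using assms unfolding has_face_sequence_def by (metis distinct_card)

lemma same_face_sequence_length:
  assumes "same_face_sequence f g"
  shows "length f = length g"
  using assms by (auto simp: same_face_sequence_def)

theorem theorem1p1:
  fixes S :: "'a topology" and V :: "'a set" and E :: "'a set set" and f1 f2 :: "nat list"
  assumes "torus S \<or> klein_bottle S"
    and "semi_equivelar_map 2 S V E [f1, f2]"
    and "curvature_zero S V E"
  shows "\<exists>T \<in> {([3,3,3,3,3,3], [3,3,3,3,6]),
               ([3,3,3,3,3,3], [3,3,3,4,4]),
               ([3,3,3,3,3,3], [3,3,4,3,4]),
               ([3,3,3,3,3,3], [3,3,4,12]),
               ([3,3,3,3,3,3], [3,3,6,6]),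
               ([3,3,3,3,6], [3,6,3,6]),
               ([3,3,3,4,4], [3,3,4,3,4]),
               ([3,3,3,4,4], [3,4,6,4]),
               ([3,3,3,4,4], [4,4,4,4]),
               ([3,3,4,3,4], [3,4,6,4]),
               ([3,3,6,6], [3,3,3,3,6]),
               ([3,3,6,6], [3,6,3,6]),
               ([3,4,4,6], [3,4,6,4]),
               ([3,4,4,6], [3,6,3,6]),
               ([3,4,6,4], [4,6,12]),
               ([3,12,12], [3,4,3,12])}.
           same_type (f1, f2) T"
proof -
  have is_map: "surface_map S V E" and distinct_types: "\<not> same_face_sequence f1 f2"
    and types: "\<And>v. v \<in> V \<Longrightarrow> has_face_sequence S V E v f1 \<or> has_face_sequence S V E v f2"
    and occurs: "\<exists>v\<in>V. has_face_sequence S V E v f1" "\<exists>v\<in>V. has_face_sequence S V E v f2"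
    using assms(2) by (auto simp: semi_equivelar_map_def numeral_2_eq_2 less_Suc_eq)
  have flat: "\<exists>f. has_face_sequence S V E v f \<and> 3 \<le> length f \<and> (\<exists>g\<in>set flat_types. same_face_sequence f g)"
    if v: "v \<in> V" for v
  proof -
    obtain f where f: "has_face_sequence S V E v f" "curvature f = 0"
      using assms(3) v unfolding curvature_zero_def by blast
    then obtain g where "g \<in> set flat_types" "same_face_sequence f g"
      using flat_face_sequence[OF has_face_sequence_ge_3[OF f(1)]] by blast
    moreover from this have "3 \<le> length f"
      using same_face_sequence_length[of f g] by (auto simp: flat_types_def)
    ultimately show ?thesis
      using f(1) by blast
  qed
  interpret polyhedral_map S V E
    by unfold_locales (use is_map flat in blast)+
  have view: "same_face_sequence f (view (v, e, F))"
    if "has_face_sequence S V E v f" "(v, e, F) \<in> flags" for v e F f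
  proof -
    have "v \<in> V"
      using that(2) by (simp add: flags_def)
    then have "3 \<le> length f"
      using flat that(1) by (metis has_face_sequence_length)
    then show ?thesis
      using same_face_sequence_view that by blast
  qed
  \<comment> \<open>The curvature hypothesis supplies some sequence of curvature zero at each
    vertex, not a priori the given \<open>f\<close>; the view of a flag at the vertex identifies the
    two up to equivalence.\<close>
  have flat_type: "\<exists>g\<in>set flat_types. same_face_sequence f g"
    if f: "\<exists>v\<in>V. has_face_sequence S V E v f" for f
  proof -
    obtain v where v: "v \<in> V" "has_face_sequence S V E v f"
      using f by blast
    obtain f' g where f': "has_face_sequence S V E v f'" "g \<in> set flat_types" "same_face_sequence f' g"
      using flat[OF v(1)] by blast
    obtain e F where "(v, e, F) \<in> flags"
      using v(1) by (rule flag_at_vertex)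
    then have "same_face_sequence f f'"
      using view v(2) f'(1) same_face_sequence_sym same_face_sequence_trans by blast
    then show ?thesis
      using f'(2,3) same_face_sequence_trans by blast
  qed
  obtain g1 where g1: "g1 \<in> set flat_types" "same_face_sequence f1 g1"
    using flat_type occurs(1) by blast
  obtain g2 where g2: "g2 \<in> set flat_types" "same_face_sequence f2 g2"
    using flat_type occurs(2) by blast
  have "g1 \<noteq> g2"
    using distinct_types g1(2) g2(2) same_face_sequence_sym same_face_sequence_trans by blast
  have dihedral: "set (dihedral g) = {w. same_face_sequence g w}" if "g \<in> set flat_types" for g
    using that by (intro set_dihedral) (auto simp: flat_types_def)
  have view1: "view (v, e, F) \<in> set (dihedral g1)"
    if "has_face_sequence S V E v f1" "(v, e, F) \<in> flags" for v e F
    using view[OF that] g1 same_face_sequence_sym same_face_sequence_trans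
    unfolding dihedral[OF g1(1)] by blast
  have view2: "view (v, e, F) \<in> set (dihedral g2)"
    if "has_face_sequence S V E v f2" "(v, e, F) \<in> flags" for v e F
    using view[OF that] g2 same_face_sequence_sym same_face_sequence_trans
    unfolding dihedral[OF g2(1)] by blast
  have views: "view \<phi> \<in> set (dihedral g1) \<union> set (dihedral g2)" if \<phi>: "\<phi> \<in> flags" for \<phi>
  proof -
    obtain v e F where "\<phi> = (v, e, F)" "v \<in> V"
      using \<phi> by (auto simp: flags_def)
    then show ?thesis
      using types view1 view2 \<phi> by blast
  qed
  let ?W = "{v \<in> V. has_face_sequence S V E v f1}"
  \<comment> \<open>A vertex with both face-sequences would make \<open>f1\<close> and
    \<open>f2\<close> equivalent through the view of a flag at it.\<close>
  have "?W \<noteq> V"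
  proof
    assume "?W = V"
    then obtain v where v: "v \<in> V" "has_face_sequence S V E v f1" "has_face_sequence S V E v f2"
      using occurs(2) by blast
    obtain e F where "(v, e, F) \<in> flags"
      using v(1) by (rule flag_at_vertex)
    then show False
      using view v distinct_types same_face_sequence_sym same_face_sequence_trans by blast
  qed
  moreover have "?W \<noteq> {}"
    using occurs(1) by blast
  ultimately obtain e u v where e: "e \<in> E" "u \<in> e \<inter> ?W" "v \<in> e \<inter> (V - ?W)"
    using connected_vertices[OF connected_torus_or_klein_bottle[OF assms(1)], of ?W] by blast
  obtain F where F: "F \<in> faces S V E" "e \<subseteq> F"
    using e(1) by (rule edge_in_face)
  have flag: "(u, e, F) \<in> flags" "(v, e, F) \<in> flags"
    using e F by (auto simp: flags_def)
  have "u \<noteq> v" "{u, v} \<subseteq> e \<inter> V"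
    using e by auto
  then have "{u, v} = e \<inter> V"
    using edge_meets_vertices(1)[OF e(1)] by (intro card_subset_eq) (auto intro: card_ge_0_finite)
  then have change: "change_vertex (u, e, F) = (v, e, F)" "change_vertex (v, e, F) = (u, e, F)"
    using other_doubleton[OF \<open>u \<noteq> v\<close>] by (simp_all add: change_vertex_def flip: \<open>{u, v} = e \<inter> V\<close>)
  have *: "view (u, e, F) \<in> set (dihedral g1)" "view (v, e, F) \<in> set (dihedral g2)"
    using view1 view2 flag e types by blast+
  have "share_edge g1 g2" "compatible g1 g2"
    using compatible_views[OF views flag(1)] * by (simp_all add: change)
  \<comment> \<open>The same edge seen from its other end; \<open>unrealizable_pairs\<close> lists
    each pair in one order, so both directions are supplied.\<close>
  moreover have "compatible g2 g1"
    using compatible_views(2)[of g2 g1, OF _ flag(2)] views * by (auto simp: change)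
  ultimately have "(g1, g2) \<in> set realizable_pairs \<or> (g2, g1) \<in> set realizable_pairs"
    using compatible_flat_types g1(1) g2(1) \<open>g1 \<noteq> g2\<close> by blast
  then have "\<exists>T \<in> set realizable_pairs. same_type (f1, f2) T"
    using g1(2) g2(2) unfolding same_type_def by (metis fst_conv snd_conv)
  then show ?thesis
    unfolding realizable_pairs_def list.set .
qed

end
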